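(* For every integer $d\geq 2$ there exists a constant $c(d)>0$ such that for every integer $n\geq 2^d$ there exists a simply connected $d$-dimensional cube complex with at most $n$ vertices and at least $c(d)\cdot n^2$ facets.
   Context: A cube complex (also called cubical complex) is a (finite) union of topological cubes such that the intersection of any two cubes is a face of both (the empty set is allowed as a face). Vertices are the $0$-dimensional cubes. The facets of a $d$-dimensional cube complex are its $d$-dimensional cubes. *)

theory Defs
  imports "HOL-Analysis.Analysis"
begin

text \<open>The unit cube \<open>[0,1]\<^sup>k\<close> is realised by extensional functions on \<open>{..<k}\<close>, inside
  \<^typ>\<open>nat \<Rightarrow> real\<close> with its product topology; \<open>unit_cube 0\<close> is a single point.
  A nonempty face is obtained by fixing some of the coordinates at 0 or 1.\<close>

definition unit_cube :: "nat \<Rightarrow> (nat \<Rightarrow> real) set" where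
  "unit_cube k = {..<k} \<rightarrow>\<^sub>E {0..1}"

definition unit_cube_faces :: "nat \<Rightarrow> (nat \<Rightarrow> real) set set" where
  "unit_cube_faces k =
     {Pi\<^sub>E {..<k} I | I. \<forall>i<k. I i = {0} \<or> I i = {1} \<or> I i = {0..1}}"

text \<open>A finite cube complex is given by its set \<open>K\<close> of (nonempty, closed) cubes. Every cube
  \<open>C \<in> K\<close> comes with a dimension \<open>dm C\<close> and a homeomorphism \<open>ch C\<close> from the unit cube of that
  dimension onto \<open>C\<close>; the faces of \<open>C\<close> are the images of the faces of the unit cube.
  The faces of a cube of the complex are cubes of the complex too. In particular, cubes meeting
  in a common face agree on how that face is subdivided into smaller faces, although the maps
  \<open>ch\<close> need not be compatible with each other. The empty face is not listed in
  \<open>cube_faces\<close>, hence the disjunct \<open>C \<inter> D = {}\<close>.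
  Since a finite cube complex is compact, metrizable and finite-dimensional, it embeds in
  \<^typ>\<open>nat \<Rightarrow> real\<close>; so that type is large enough as ambient space for existence statements.\<close>

definition cube_faces :: "nat \<Rightarrow> ((nat \<Rightarrow> real) \<Rightarrow> 'a) \<Rightarrow> 'a set set" where
  "cube_faces k h = (\<lambda>F. h ` F) ` unit_cube_faces k"

definition cube_complex ::
  "'a::t2_space set set \<Rightarrow> ('a set \<Rightarrow> nat) \<Rightarrow> ('a set \<Rightarrow> (nat \<Rightarrow> real) \<Rightarrow> 'a) \<Rightarrow> bool" where
  "cube_complex K dm ch \<longleftrightarrow>
     finite K \<and>
     (\<forall>C\<in>K. \<exists>g. homeomorphism (unit_cube (dm C)) C (ch C) g) \<and>
     (\<forall>C\<in>K. cube_faces (dm C) (ch C) \<subseteq> K) \<and>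
     (\<forall>C\<in>K. \<forall>D\<in>K. C \<inter> D = {} \<or>
        C \<inter> D \<in> cube_faces (dm C) (ch C) \<and> C \<inter> D \<in> cube_faces (dm D) (ch D))"

definition cubes_of_dim :: "'a set set \<Rightarrow> ('a set \<Rightarrow> nat) \<Rightarrow> nat \<Rightarrow> 'a set set" where
  "cubes_of_dim K dm k = {C \<in> K. dm C = k}"

abbreviation vertices :: "'a set set \<Rightarrow> ('a set \<Rightarrow> nat) \<Rightarrow> 'a set set" where
  "vertices K dm \<equiv> cubes_of_dim K dm 0"

definition has_dimension :: "'a set set \<Rightarrow> ('a set \<Rightarrow> nat) \<Rightarrow> nat \<Rightarrow> bool" where
  "has_dimension K dm d \<longleftrightarrow> (\<forall>C\<in>K. dm C \<le> d) \<and> (\<exists>C\<in>K. dm C = d)"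

end

theory Submission
  imports Defs
begin

text \<open>
  Multiplying a complex by \<open>[0,1]\<close> doubles the vertices and keeps the number of facets, so it is
  enough to find contractible square complexes with \<open>O(m)\<close> vertices and at least \<open>m\<^sup>2\<close> squares.
  They are built from bipartite graphs: whenever a path \<open>i j' i' j\<close> of three edges has end points
  that are not yet adjacent, one may add the edge \<open>i j\<close> and the square on these four vertices. This
  is the inverse of an elementary collapse, and the squares keep meeting in common faces as long as
  no diagonal is used twice.

  A complete bipartite graph on \<open>m + m\<close> vertices can be doubled at the cost of \<open>12 m\<close> new
  vertices. Four parallel copies \<open>(u, b)\<close> of it are hung onto the given one, \<open>(p, q)\<close>; each edge of
  such a copy arises from one square, so all new diagonals are fresh. The \<open>2m + 2m\<close> new vertices
  fall into two halves on either side, and each of the four pairs of halves is joined completely by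
  means of its own copy. Iterating gives \<open>K\<^sub>m\<^sub>,\<^sub>m\<close>, hence about \<open>m\<^sup>2\<close> squares, on \<open>O(m)\<close> vertices.
\<close>

text \<open>New vertices cannot be avoided. Every attached square brings one edge that closes a
  cycle, so a complex whose graph is exactly a complete bipartite graph on \<open>m + m\<close>
  vertices has \<open>(m - 1)^2\<close> squares, one for each edge outside a spanning tree. Each
  colour class offers only \<open>m (m - 1) / 2\<close> pairs as diagonals, which is too few once
  \<open>m > 2\<close>. Hence the old vertices are kept as scaffolding, and the larger graph lives
  on new ones. The price stays linear: a doubling adds \<open>12 m\<close> vertices, and over all
  doublings these costs form a geometric series.

  The property carried along is contractibility and not just simple connectedness. It passes through
  an elementary collapse by an explicit deformation and through a product with an interval, without
  any discussion of loops; loops enter only once, at the end.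

  The converse bound explains the exponent 2: squares with distinct diagonals number at most
  quadratically many in the vertices, so a construction of this kind can do no better than a
  constant times \<open>n^2\<close>.\<close>

subsection \<open>Bipartite square complexes built by elementary collapses\<close>

text \<open>\<open>U\<close> and \<open>B\<close> are the two colour classes of vertices, an edge is listed with its end in \<open>U\<close>
  first, and a square is given by its two diagonals. Two vertices of the same colour in a square are
  opposite, so that two squares with different diagonals share at most an edge.\<close>

inductive built :: "'a set \<Rightarrow> 'a set \<Rightarrow> ('a \<times> 'a) set \<Rightarrow> ('a set \<times> 'a set) set \<Rightarrow> bool" where
  edge: "i \<noteq> j \<Longrightarrow> built {i} {j} {(i, j)} {}"
| leafU: "\<lbrakk>built U B E Q; i \<notin> U \<union> B; j \<in> B\<rbrakk> \<Longrightarrow> built (insert i U) B (insert (i, j) E) Q"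
| leafB: "\<lbrakk>built U B E Q; j \<notin> U \<union> B; i \<in> U\<rbrakk> \<Longrightarrow> built U (insert j B) (insert (i, j) E) Q"
| square: "\<lbrakk>built U B E Q; (i, j') \<in> E; (i', j') \<in> E; (i', j) \<in> E; (i, j) \<notin> E;
     {i, i'} \<notin> fst ` Q; {j, j'} \<notin> snd ` Q\<rbrakk>
   \<Longrightarrow> built U B (insert (i, j) E) (insert ({i, i'}, {j, j'}) Q)"

lemma built_finite: "built U B E Q \<Longrightarrow> finite U \<and> finite B \<and> finite E \<and> finite Q"
  by (induction rule: built.induct) auto

lemma built_wf:
  "built U B E Q \<Longrightarrow> U \<inter> B = {} \<and> E \<subseteq> U \<times> B \<and> Q \<subseteq> Pow U \<times> Pow B"
  by (induction rule: built.induct) auto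

text \<open>The freshness premises of \<open>square\<close> are what the induction needs.
  Geometrically, a square is determined by either of its diagonals, so that two squares never share
  two opposite vertices.\<close>

lemma built_inj_diagonals: "built U B E Q \<Longrightarrow> inj_on fst Q \<and> inj_on snd Q"
proof (induction rule: built.induct)
  case (square U B E Q i j' i' j)
  then show ?case
    unfolding inj_on_insert fst_conv snd_conv by blast
qed simp_all

lemma built_square_edges:
  "built U B E Q \<Longrightarrow> (I, J) \<in> Q \<Longrightarrow> card I = 2 \<and> card J = 2 \<and> I \<times> J \<subseteq> E"
proof (induction rule: built.induct)
  case (square U B E Q i j' i' j)
  show ?case
  proof (cases "(I, J) \<in> Q")
    case False
    then have "I = {i, i'}" "J = {j, j'}" using square.prems by simp_all
    \<comment> \<open>If two opposite vertices were equal, the edge \<open>(i, j)\<close> to be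
      added would already be an edge of the path.\<close>
    moreover have "i \<noteq> i'" "j \<noteq> j'" using square.hyps by auto
    ultimately show ?thesis using square.hyps(2-4) by simp
  qed (use square.IH in blast)
qed (simp, blast+)

section \<open>Attaching whole families of leaves and squares, and the doubling step\<close>

lemma built_leavesU:
  assumes "finite X" "built U B E Q" "inj_on a X" "a ` X \<inter> (U \<union> B) = {}" "\<phi> ` X \<subseteq> B"
  shows "built (U \<union> a ` X) B (E \<union> (\<lambda>x. (a x, \<phi> x)) ` X) Q"
  using assms
proof (induction X rule: finite_induct)
  case (insert x X)
  then have "built (insert (a x) (U \<union> a ` X)) B (insert (a x, \<phi> x) (E \<union> (\<lambda>x. (a x, \<phi> x)) ` X)) Q"
    by (intro built.leafU) (auto simp: inj_on_insert)
  then show ?case by simp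
qed simp

lemma built_leavesB:
  assumes "finite X" "built U B E Q" "inj_on a X" "a ` X \<inter> (U \<union> B) = {}" "\<phi> ` X \<subseteq> U"
  shows "built U (B \<union> a ` X) (E \<union> (\<lambda>x. (\<phi> x, a x)) ` X) Q"
  using assms
proof (induction X rule: finite_induct)
  case (insert x X)
  then have "built U (insert (a x) (B \<union> a ` X)) (insert (\<phi> x, a x) (E \<union> (\<lambda>x. (\<phi> x, a x)) ` X)) Q"
    by (intro built.leafB) (auto simp: inj_on_insert)
  then show ?case by simp
qed simp

text \<open>All paths run in the old edge set \<open>E\<close>, so the squares can be attached one
  after the other in any order. The injectivity assumptions keep the edges and diagonals created on
  the way from getting in conflict with later ones; they also make the squares pairwise distinct,
  which gives the count.\<close>

lemma built_squares_family:
  assumes "finite X" "built U B E Q"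
    and "\<And>x. x \<in> X \<Longrightarrow> (i x, j' x) \<in> E \<and> (i' x, j' x) \<in> E \<and> (i' x, j x) \<in> E \<and> (i x, j x) \<notin> E"
    and "inj_on (\<lambda>x. (i x, j x)) X"
    and "inj_on (\<lambda>x. {i x, i' x}) X" "\<And>x. x \<in> X \<Longrightarrow> {i x, i' x} \<notin> fst ` Q"
    and "inj_on (\<lambda>x. {j x, j' x}) X" "\<And>x. x \<in> X \<Longrightarrow> {j x, j' x} \<notin> snd ` Q"
  shows "built U B (E \<union> (\<lambda>x. (i x, j x)) ` X) (Q \<union> (\<lambda>x. ({i x, i' x}, {j x, j' x})) ` X) \<and>
    card (Q \<union> (\<lambda>x. ({i x, i' x}, {j x, j' x})) ` X) = card Q + card X"
  using assms
proof (induction X rule: finite_induct)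
  case (insert x X)
  let ?E = "E \<union> (\<lambda>x. (i x, j x)) ` X" and ?Q = "Q \<union> (\<lambda>x. ({i x, i' x}, {j x, j' x})) ` X"
  note prems = insert.prems
  have inj: "inj_on (\<lambda>x. (i x, j x)) X" "inj_on (\<lambda>x. {i x, i' x}) X" "inj_on (\<lambda>x. {j x, j' x}) X"
    using prems(3,4,6) inj_on_subset subset_insertI by metis+
  have notin: "(i x, j x) \<notin> (\<lambda>x. (i x, j x)) ` X" "{i x, i' x} \<notin> (\<lambda>x. {i x, i' x}) ` X"
      "{j x, j' x} \<notin> (\<lambda>x. {j x, j' x}) ` X"
    using prems(3,4,6) insert.hyps(2) unfolding inj_on_insert by blast+
  have IH: "built U B ?E ?Q" "card ?Q = card Q + card X"
    using insert.IH[OF prems(1) prems(2) inj(1,2) prems(5) inj(3) prems(7)] by blast+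
  have path: "(i x, j' x) \<in> ?E" "(i' x, j' x) \<in> ?E" "(i' x, j x) \<in> ?E" "(i x, j x) \<notin> ?E"
    using prems(2)[of x] notin(1) by blast+
  have fresh: "{i x, i' x} \<notin> fst ` ?Q" "{j x, j' x} \<notin> snd ` ?Q"
    unfolding image_Un image_image fst_conv snd_conv Un_iff
    using prems(5)[of x] prems(7)[of x] notin(2,3) by blast+
  have "({i x, i' x}, {j x, j' x}) \<notin> ?Q"
    using fresh(1) imageI[of "({i x, i' x}, {j x, j' x})" ?Q fst, unfolded fst_conv] by (rule contrapos_nn)
  then have "card (insert ({i x, i' x}, {j x, j' x}) ?Q) = Suc (card ?Q)"
    using IH built_finite by (intro card_insert_disjoint) blast+
  with built.square[OF IH(1) path fresh] show ?case
    using IH insert.hyps by simp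
qed simp

text \<open>Only the vertices named by \<open>p\<close> and \<open>q\<close> are used by the next
  doubling. All others are scaffolding which has to be counted in \<open>N\<close>, and further
  edges are allowed. Keeping \<open>N\<close> and \<open>S\<close> as mere bounds spares exact
  bookkeeping.\<close>

definition contains_biclique :: "nat \<Rightarrow> nat \<Rightarrow> nat \<Rightarrow> bool" where
  "contains_biclique m N S \<longleftrightarrow> (\<exists>(U :: nat set) B E Q p q. built U B E Q \<and>
     inj_on p {..<m} \<and> inj_on q {..<m} \<and> (\<forall>i<m. \<forall>j<m. (p i, q j) \<in> E) \<and>
     card U + card B \<le> N \<and> S \<le> card Q)"

text \<open>A supply of new vertex names indexed by any countable type. With tagged tuples as
  indices, distinctness of names reduces to distinctness of tuples.\<close>

lemma fresh_inj:
  assumes "finite (A :: nat set)"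
  obtains f :: "'b :: countable \<Rightarrow> nat" where "inj f" "range f \<inter> A = {}"
proof
  have "infinite (- A)" using assms by simp
  then have "inj (enumerate (- A))" "range (enumerate (- A)) = - A"
    using strict_mono_enumerate strict_mono_imp_inj_on range_enumerate by blast+
  then show "inj (enumerate (- A) \<circ> (to_nat :: 'b \<Rightarrow> nat))"
      "range (enumerate (- A) \<circ> (to_nat :: 'b \<Rightarrow> nat)) \<inter> A = {}"
    by (auto intro: inj_compose)
qed

text \<open>Every copy is a prism over the given graph with the colours swapped:
  \<open>u s t j\<close> stands over \<open>q j\<close> and \<open>b s t i\<close> over
  \<open>p i\<close>, and each edge spans a square with the edge above it. The final join is a
  second prism, with \<open>W s i\<close> over \<open>b s t i\<close> and \<open>Z t j\<close> over
  \<open>u s t j\<close>, which swaps the colours back. A single copy would fail here: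
  \<open>Z 0 j\<close> and \<open>Z 1 j\<close> would both ask for the diagonal of
  \<open>W s i\<close> and the same vertex \<open>u\<close>. With one copy per pair
  \<open>(s, t)\<close> each diagonal determines all four indices. The vertices added are
  \<open>4 m + 4 m\<close> in the copies and \<open>2 m + 2 m\<close> in \<open>W\<close> and
  \<open>Z\<close>. The bound \<open>4 * m * m\<close> is the number of squares in the last layer
  alone.\<close>

lemma contains_biclique_double:
  assumes "contains_biclique m N S"
  shows "contains_biclique (2 * m) (N + 12 * m) (4 * m * m)"
proof -
  obtain U B :: "nat set" and E Q p q where st: "built U B E Q"
    and p: "inj_on p {..<m}" and q: "inj_on q {..<m}"
    and pq: "\<And>i j. i < m \<Longrightarrow> j < m \<Longrightarrow> (p i, q j) \<in> E"
    and N: "card U + card B \<le> N"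
    using assms unfolding contains_biclique_def by blast
  have fin: "finite U" "finite B" using built_finite[OF st] by auto
  then have "finite (U \<union> B)" by simp
  then obtain f :: "nat \<times> nat \<times> nat \<times> nat \<Rightarrow> nat"
    where f: "inj f" "range f \<inter> (U \<union> B) = {}" by (rule fresh_inj)
  \<comment> \<open>The copies are indexed by \<open>s, t < 2\<close>: copy \<open>(s, t)\<close> joins the \<open>s\<close>-th half of \<open>W\<close> to the \<open>t\<close>-th half of \<open>Z\<close>.\<close>
  define u b where "u = (\<lambda>s t j. f (0, s, t, j))" and "b = (\<lambda>s t i. f (1, s, t, i))"
  \<comment> \<open>The second index is merely repeated, so that one injection \<open>f\<close> on
    quadruples names all four families; the first entry tells them apart.\<close>
  define W Z where "W = (\<lambda>s i. f (2, s, s, i))" and "Z = (\<lambda>t j. f (3, t, t, j))"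
  have notin: "f x \<notin> U" "f x \<notin> B" for x using f(2) by auto
  have wf: "E \<subseteq> U \<times> B" "Q \<subseteq> Pow U \<times> Pow B" "U \<inter> B = {}" using built_wf[OF st] by auto
  have pU: "p i \<in> U" and qB: "q i \<in> B" if "i < m" for i
    using pq[OF that that] wf(1) by auto
  have finj: "f x = f y \<longleftrightarrow> x = y" for x y using f(1) by (auto dest: injD)
  have pinj: "p i = p i' \<longleftrightarrow> i = i'" "q i = q i' \<longleftrightarrow> i = i'" if "i < m" "i' < m" for i i'
    using p q that by (auto dest: inj_onD)
  have inj: "u s t j = u s' t' j' \<longleftrightarrow> s = s' \<and> t = t' \<and> j = j'"
    "b s t j = b s' t' j' \<longleftrightarrow> s = s' \<and> t = t' \<and> j = j'"
    "W s j = W s' j' \<longleftrightarrow> s = s' \<and> j = j'" "Z s j = Z s' j' \<longleftrightarrow> s = s' \<and> j = j'"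
    for s t j s' t' j' by (auto simp: u_def b_def W_def Z_def finj)
  have ne: "u s t j \<noteq> b s' t' j'" "u s t j \<noteq> W s' j'" "u s t j \<noteq> Z s' j'"
    "b s t j \<noteq> W s' j'" "b s t j \<noteq> Z s' j'" "W s j \<noteq> Z s' j'"
    for s t j s' t' j' by (auto simp: u_def b_def W_def Z_def finj)
  have new: "u s t j \<notin> U" "u s t j \<notin> B" "b s t j \<notin> U" "b s t j \<notin> B"
    "W s j \<notin> U" "W s j \<notin> B" "Z s j \<notin> U" "Z s j \<notin> B"
    for s t j by (auto simp: u_def b_def W_def Z_def notin)
  have pqne: "p i \<noteq> u s t j" "p i \<noteq> b s t j" "p i \<noteq> W s j" "p i \<noteq> Z s j"
     "q i \<noteq> u s t j" "q i \<noteq> b s t j" "q i \<noteq> W s j" "q i \<noteq> Z s j"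
    if "i < m" for i s t j
    using pU[OF that] qB[OF that] new by metis+
  \<comment> \<open>These rules decide every equality between vertex names, so that all freshness
    conditions on diagonals become case checks on indices.\<close>
  note simps = inj ne ne[symmetric] new pqne pqne[symmetric] pinj pU qB doubleton_eq_iff

  define X where "X = {..<2 :: nat} \<times> {..<2 :: nat} \<times> {..<m}"
  define Y where "Y = {..<2 :: nat} \<times> {..<m}"
  define T where "T = {..<2 :: nat} \<times> {..<2 :: nat} \<times> {..<m} \<times> {..<m}"
  have finX: "finite X" "finite Y" "finite T" by (auto simp: X_def Y_def T_def)
  have card: "card X = 4 * m" "card Y = 2 * m" "card T = 4 * m * m"
    by (auto simp: X_def Y_def T_def card_cartesian_product)
  have Qnew: "({v, w}, J) \<notin> Q" if "v \<notin> U \<or> w \<notin> U" for v w J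
    using wf(2) that by auto
  have Qnew': "(I, {v, w}) \<notin> Q" if "v \<notin> B \<or> w \<notin> B" for v w I
    using wf(2) that by auto
  have Enew: "v \<notin> U \<Longrightarrow> (v, w) \<notin> E" "w \<notin> B \<Longrightarrow> (v, w) \<notin> E" for v w
    using wf(1) by auto

  define U1 where "U1 = U \<union> (\<lambda>(s, t, j). u s t j) ` X"
  define B1 where "B1 = B \<union> (\<lambda>(s, t, i). b s t i) ` X"
  define U2 where "U2 = U1 \<union> (\<lambda>(s, i). W s i) ` Y"
  define B2 where "B2 = B1 \<union> (\<lambda>(t, j). Z t j) ` Y"

  define E1 where "E1 = E \<union> (\<lambda>x. (case x of (s, t, j) \<Rightarrow> u s t j, case x of (s, t, j) \<Rightarrow> q j)) ` X"
  have st1: "built U1 B E1 Q"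
    unfolding U1_def E1_def
    by (rule built_leavesU[OF finX(1) st, where a = "\<lambda>(s, t, j). u s t j" and \<phi> = "\<lambda>(s, t, j). q j"])
       (auto simp: simps inj_on_def image_iff X_def Y_def)
  define E2 where "E2 = E1 \<union> (\<lambda>x. (case x of (s, t, i) \<Rightarrow> p i, case x of (s, t, i) \<Rightarrow> b s t i)) ` X"
  have st2: "built U1 B1 E2 Q"
    unfolding B1_def E2_def
    by (rule built_leavesB[OF finX(1) st1, where a = "\<lambda>(s, t, i). b s t i" and \<phi> = "\<lambda>(s, t, i). p i"])
       (auto simp: simps inj_on_def image_iff X_def Y_def U1_def)
  \<comment> \<open>A leaf can bring only one edge. Therefore \<open>W s i\<close> is hung onto copy
    \<open>(s, 0)\<close> and, below, \<open>Z t j\<close> onto copy \<open>(0, t)\<close>; the edge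
    to the other copy closes a cycle and has to come with a square.\<close>
  define E3 where "E3 = E2 \<union> (\<lambda>x. (case x of (s, i) \<Rightarrow> W s i, case x of (s, i) \<Rightarrow> b s 0 i)) ` Y"
  have st3: "built U2 B1 E3 Q"
    unfolding U2_def E3_def
    by (rule built_leavesU[OF finX(2) st2, where a = "\<lambda>(s, i). W s i" and \<phi> = "\<lambda>(s, i). b s 0 i"])
       (auto simp: simps inj_on_def image_iff X_def Y_def U1_def B1_def)
  define E4 where "E4 = E3 \<union> (\<lambda>x. (case x of (t, j) \<Rightarrow> u 0 t j, case x of (t, j) \<Rightarrow> Z t j)) ` Y"
  have st4: "built U2 B2 E4 Q"
    unfolding B2_def E4_def
    by (rule built_leavesB[OF finX(2) st3, where a = "\<lambda>(t, j). Z t j" and \<phi> = "\<lambda>(t, j). u 0 t j"])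
       (auto simp: simps inj_on_def image_iff X_def Y_def U1_def B1_def U2_def)
  have E4_mem: "E4 = E \<union> {(u s t j, q j) | s t j. s < 2 \<and> t < 2 \<and> j < m} \<union> {(p i, b s t i) | s t i. s < 2 \<and> t < 2 \<and> i < m}
      \<union> {(W s i, b s 0 i) | s i. s < 2 \<and> i < m} \<union> {(u 0 t j, Z t j) | t j. t < 2 \<and> j < m}"
  proof -
    have "(\<lambda>x. (case x of (s, t, j) \<Rightarrow> u s t j, case x of (s, t, j) \<Rightarrow> q j)) ` X =
        {(u s t j, q j) | s t j. s < 2 \<and> t < 2 \<and> j < m}"
      by (auto simp: X_def image_iff) blast
    moreover have "(\<lambda>x. (case x of (s, t, i) \<Rightarrow> p i, case x of (s, t, i) \<Rightarrow> b s t i)) ` X =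
        {(p i, b s t i) | s t i. s < 2 \<and> t < 2 \<and> i < m}"
      by (auto simp: X_def image_iff) blast
    moreover have "(\<lambda>x. (case x of (s, i) \<Rightarrow> W s i, case x of (s, i) \<Rightarrow> b s 0 i)) ` Y =
        {(W s i, b s 0 i) | s i. s < 2 \<and> i < m}"
      by (auto simp: Y_def image_iff) blast
    moreover have "(\<lambda>x. (case x of (t, j) \<Rightarrow> u 0 t j, case x of (t, j) \<Rightarrow> Z t j)) ` Y =
        {(u 0 t j, Z t j) | t j. t < 2 \<and> j < m}"
      by (auto simp: Y_def image_iff) blast
    ultimately show ?thesis
      unfolding E4_def E3_def E2_def E1_def by (simp only: Un_assoc)
  qed

  \<comment> \<open>\<open>u s t j\<close> and \<open>b s t i\<close> are joined via \<open>q j\<close> and \<open>p i\<close>.\<close>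
  define E5 where "E5 = E4 \<union> {(u s t j, b s t i) | s t i j. s < 2 \<and> t < 2 \<and> i < m \<and> j < m}"
  define Q5 where "Q5 = Q \<union> (\<lambda>(s, t, i, j). ({u s t j, p i}, {b s t i, q j})) ` T"
  have "built U2 B2 (E4 \<union> (\<lambda>x. (case x of (s, t, i, j) \<Rightarrow> u s t j, case x of (s, t, i, j) \<Rightarrow> b s t i)) ` T)
     (Q \<union> (\<lambda>x. ({case x of (s, t, i, j) \<Rightarrow> u s t j, case x of (s, t, i, j) \<Rightarrow> p i},
          {case x of (s, t, i, j) \<Rightarrow> b s t i, case x of (s, t, i, j) \<Rightarrow> q j})) ` T) \<and>
     card (Q \<union> (\<lambda>x. ({case x of (s, t, i, j) \<Rightarrow> u s t j, case x of (s, t, i, j) \<Rightarrow> p i},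
          {case x of (s, t, i, j) \<Rightarrow> b s t i, case x of (s, t, i, j) \<Rightarrow> q j})) ` T) = card Q + card T"
    apply (rule built_squares_family[OF finX(3) st4])
    subgoal by (auto simp: simps pq Enew T_def E4_mem)
    subgoal by (auto simp: simps inj_on_def T_def)
    subgoal by (auto simp: simps inj_on_def T_def)
    subgoal by (auto simp: simps T_def image_iff Qnew Qnew')
    subgoal by (auto simp: simps inj_on_def T_def)
    subgoal by (auto simp: simps T_def image_iff Qnew Qnew')
    done
  moreover have "(\<lambda>x. (case x of (s, t, i, j) \<Rightarrow> u s t j, case x of (s, t, i, j) \<Rightarrow> b s t i)) ` T =
      {(u s t j, b s t i) | s t i j. s < 2 \<and> t < 2 \<and> i < m \<and> j < m}"
    by (auto simp: T_def image_iff) blast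
  ultimately have st5: "built U2 B2 E5 Q5" "card Q5 = card Q + card T"
    unfolding E5_def Q5_def by (simp_all add: case_prod_unfold)
  note E5_mem = E5_def E4_mem and Q5_mem = Q5_def T_def

  \<comment> \<open>\<open>W s i\<close> needs an edge to both copies \<open>(s, 0)\<close> and \<open>(s, 1)\<close>: the second one comes via \<open>b s 0 i\<close> and \<open>p i\<close>.\<close>
  define E6 where "E6 = E5 \<union> {(W s i, b s 1 i) | s i. s < 2 \<and> i < m}"
  define Q6 where "Q6 = Q5 \<union> (\<lambda>(s, i). ({W s i, p i}, {b s 1 i, b s 0 i})) ` Y"
  have "built U2 B2 (E5 \<union> (\<lambda>x. (case x of (s, i) \<Rightarrow> W s i, case x of (s, i) \<Rightarrow> b s 1 i)) ` Y)
     (Q5 \<union> (\<lambda>x. ({case x of (s, i) \<Rightarrow> W s i, case x of (s, i) \<Rightarrow> p i},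
          {case x of (s, i) \<Rightarrow> b s 1 i, case x of (s, i) \<Rightarrow> b s 0 i})) ` Y) \<and>
     card (Q5 \<union> (\<lambda>x. ({case x of (s, i) \<Rightarrow> W s i, case x of (s, i) \<Rightarrow> p i},
          {case x of (s, i) \<Rightarrow> b s 1 i, case x of (s, i) \<Rightarrow> b s 0 i})) ` Y) = card Q5 + card Y"
    apply (rule built_squares_family[OF finX(2) st5(1)])
    subgoal by (auto simp: simps pq Enew Y_def E5_mem)
    subgoal by (auto simp: simps inj_on_def Y_def)
    subgoal by (auto simp: simps inj_on_def Y_def)
    subgoal by (auto simp: simps Y_def image_iff Qnew Qnew' Q5_mem)
    subgoal by (auto simp: simps inj_on_def Y_def)
    subgoal by (auto simp: simps Y_def image_iff Qnew Qnew' Q5_mem)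
    done
  moreover have "(\<lambda>x. (case x of (s, i) \<Rightarrow> W s i, case x of (s, i) \<Rightarrow> b s 1 i)) ` Y =
      {(W s i, b s 1 i) | s i. s < 2 \<and> i < m}"
    by (auto simp: Y_def image_iff) blast
  ultimately have st6: "built U2 B2 E6 Q6" "card Q6 = card Q5 + card Y"
    unfolding E6_def Q6_def by (simp_all add: case_prod_unfold)
  note E6_mem = E6_def E5_mem and Q6_mem = Q6_def Q5_mem Y_def

  \<comment> \<open>The missing edge from \<open>Z t j\<close> to copy \<open>(1, t)\<close> comes
    from the path \<open>u 1 t j\<close>, \<open>q j\<close>, \<open>u 0 t j\<close>,
    \<open>Z t j\<close>.\<close>
  define E7 where "E7 = E6 \<union> {(u 1 t j, Z t j) | t j. t < 2 \<and> j < m}"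
  define Q7 where "Q7 = Q6 \<union> (\<lambda>(t, j). ({u 1 t j, u 0 t j}, {Z t j, q j})) ` Y"
  have "built U2 B2 (E6 \<union> (\<lambda>x. (case x of (t, j) \<Rightarrow> u 1 t j, case x of (t, j) \<Rightarrow> Z t j)) ` Y)
     (Q6 \<union> (\<lambda>x. ({case x of (t, j) \<Rightarrow> u 1 t j, case x of (t, j) \<Rightarrow> u 0 t j},
          {case x of (t, j) \<Rightarrow> Z t j, case x of (t, j) \<Rightarrow> q j})) ` Y) \<and>
     card (Q6 \<union> (\<lambda>x. ({case x of (t, j) \<Rightarrow> u 1 t j, case x of (t, j) \<Rightarrow> u 0 t j},
          {case x of (t, j) \<Rightarrow> Z t j, case x of (t, j) \<Rightarrow> q j})) ` Y) = card Q6 + card Y"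
    apply (rule built_squares_family[OF finX(2) st6(1)])
    subgoal by (auto simp: simps pq Enew Y_def E6_mem)
    subgoal by (auto simp: simps inj_on_def Y_def)
    subgoal by (auto simp: simps inj_on_def Y_def)
    subgoal by (auto simp: simps Y_def image_iff Qnew Qnew' Q6_mem)
    subgoal by (auto simp: simps inj_on_def Y_def)
    subgoal by (auto simp: simps Y_def image_iff Qnew Qnew' Q6_mem)
    done
  moreover have "(\<lambda>x. (case x of (t, j) \<Rightarrow> u 1 t j, case x of (t, j) \<Rightarrow> Z t j)) ` Y =
      {(u 1 t j, Z t j) | t j. t < 2 \<and> j < m}"
    by (auto simp: Y_def image_iff) blast
  ultimately have st7: "built U2 B2 E7 Q7" "card Q7 = card Q6 + card Y"
    unfolding E7_def Q7_def by (simp_all add: case_prod_unfold)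
  have less2: "s = 0 \<or> s = 1" if "s < 2" for s :: nat using that by auto
  \<comment> \<open>The last layer needs just these facts about \<open>E7\<close>: three sides of
    each square are present and the fourth is absent.\<close>
  have WbE7: "(W s i, b s t i) \<in> E7" if "s < 2" "t < 2" "i < m" for s t i
    using that less2[OF that(2)] unfolding E7_def E6_def E5_def E4_mem by blast
  have uZE7: "(u s t j, Z t j) \<in> E7" if "s < 2" "t < 2" "j < m" for s t j
    using that less2[OF that(1)] unfolding E7_def E6_def E5_def E4_mem by blast
  have ubE7: "(u s t j, b s t i) \<in> E7" if "s < 2" "t < 2" "i < m" "j < m" for s t i j
    using that unfolding E7_def E6_def E5_def by blast
  have WZE7: "(W s i, Z t j) \<notin> E7" for s t i j
    by (auto simp: E7_def E6_mem simps Enew)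
  note E7_mem = WbE7 uZE7 ubE7 WZE7 and Q7_mem = Q7_def Q6_mem

  \<comment> \<open>\<open>W s i\<close> and \<open>Z t j\<close> are joined via \<open>b s t i\<close> and \<open>u s t j\<close>.\<close>
  define E8 where "E8 = E7 \<union> {(W s i, Z t j) | s t i j. s < 2 \<and> t < 2 \<and> i < m \<and> j < m}"
  define Q8 where "Q8 = Q7 \<union> (\<lambda>(s, t, i, j). ({W s i, u s t j}, {Z t j, b s t i})) ` T"
  have "built U2 B2 (E7 \<union> (\<lambda>x. (case x of (s, t, i, j) \<Rightarrow> W s i, case x of (s, t, i, j) \<Rightarrow> Z t j)) ` T)
     (Q7 \<union> (\<lambda>x. ({case x of (s, t, i, j) \<Rightarrow> W s i, case x of (s, t, i, j) \<Rightarrow> u s t j},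
          {case x of (s, t, i, j) \<Rightarrow> Z t j, case x of (s, t, i, j) \<Rightarrow> b s t i})) ` T) \<and>
     card (Q7 \<union> (\<lambda>x. ({case x of (s, t, i, j) \<Rightarrow> W s i, case x of (s, t, i, j) \<Rightarrow> u s t j},
          {case x of (s, t, i, j) \<Rightarrow> Z t j, case x of (s, t, i, j) \<Rightarrow> b s t i})) ` T) = card Q7 + card T"
    apply (rule built_squares_family[OF finX(3) st7(1)])
    subgoal by (auto simp: simps pq Enew T_def E7_mem)
    subgoal by (auto simp: simps inj_on_def T_def)
    subgoal by (auto simp: simps inj_on_def T_def)
    subgoal by (auto simp: simps T_def image_iff Qnew Qnew' Q7_mem)
    subgoal by (auto simp: simps inj_on_def T_def)
    subgoal by (auto simp: simps T_def image_iff Qnew Qnew' Q7_mem)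
    done
  moreover have "(\<lambda>x. (case x of (s, t, i, j) \<Rightarrow> W s i, case x of (s, t, i, j) \<Rightarrow> Z t j)) ` T =
      {(W s i, Z t j) | s t i j. s < 2 \<and> t < 2 \<and> i < m \<and> j < m}"
    by (auto simp: T_def image_iff inj)
  ultimately have st8: "built U2 B2 E8 Q8" "card Q8 = card Q7 + card T"
    unfolding E8_def Q8_def by (simp_all add: case_prod_unfold)

  \<comment> \<open>The parity of \<open>k\<close> selects the half and \<open>k div 2\<close> the
    position in it.\<close>
  define p' q' where "p' = (\<lambda>k. W (k mod 2) (k div 2))" and "q' = (\<lambda>k. Z (k mod 2) (k div 2))"
  have "inj p'" "inj q'"
    unfolding p'_def q'_def inj_def inj by (metis div_mult_mod_eq)+
  then have "inj_on p' {..<2 * m}" "inj_on q' {..<2 * m}"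
    using inj_on_subset by blast+
  moreover have "(p' i, q' j) \<in> E8" if "i < 2 * m" "j < 2 * m" for i j
  proof -
    have "i mod 2 < 2" "j mod 2 < 2" "i div 2 < m" "j div 2 < m" using that by auto
    then show ?thesis unfolding E8_def p'_def q'_def by blast
  qed
  moreover have "card U2 + card B2 \<le> N + 12 * m"
  proof -
    have "card U2 \<le> card U + card X + card Y"
      unfolding U2_def U1_def using finX fin
      by (meson add_mono card_Un_le card_image_le le_refl order_trans)
    moreover have "card B2 \<le> card B + card X + card Y"
      unfolding B2_def B1_def using finX fin
      by (meson add_mono card_Un_le card_image_le le_refl order_trans)
    ultimately show ?thesis using N card by linarith
  qed
  moreover have "4 * m * m \<le> card Q8"
    using st8(2) card(3) by linarith
  ultimately show ?thesis
    unfolding contains_biclique_def using st8(1) by blast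
qed

text \<open>Start of the doubling, and with only four vertices also the complex that serves small
  \<open>n\<close> in the theorem.\<close>

lemma built_single_square:
  "built {2, 0 :: nat} {3, 1} {(2, 3), (0, 3), (2, 1), (0, 1)} {({2, 0}, {3, 1})}"
proof -
  have "built {0 :: nat} {1} {(0, 1)} {}" by (rule built.edge) simp
  then have "built (insert 2 {0 :: nat}) {1} (insert (2, 1) {(0, 1)}) {}"
    by (rule built.leafU) auto
  then have "built {2, 0 :: nat} (insert 3 {1}) (insert (0, 3) {(2, 1), (0, 1)}) {}"
    by (rule built.leafB) auto
  then show ?thesis
    by (rule built.square) auto
qed

text \<open>The constant 12 reproduces itself: passing from \<open>2 ^ k\<close> to
  \<open>2 ^ Suc k\<close> costs \<open>12 * 2 ^ k\<close> vertices, as many as are already allowed.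
  The last layer then has \<open>4 * 2 ^ k * 2 ^ k = 4 ^ Suc k\<close> squares.\<close>

lemma contains_biclique_power: "contains_biclique (2 ^ k) (12 * 2 ^ k) (4 ^ k)"
proof (induction k)
  case 0
  from built_single_square show ?case
    unfolding contains_biclique_def
    by (intro exI[of _ "{2, 0}"] exI[of _ "{3, 1}"] exI[of _ "insert (2, 3) {(0, 3), (2, 1), (0, 1)}"]
      exI[of _ "{({2, 0}, {3, 1})}"] exI[of _ "\<lambda>_. 0"] exI[of _ "\<lambda>_. 1"]) (auto simp: inj_on_def)
next
  case (Suc k)
  have "(4 :: nat) ^ Suc k = 4 * 2 ^ k * 2 ^ k"
    by (simp add: power_mult_distrib[symmetric])
  with contains_biclique_double[OF Suc] show ?case by (simp add: algebra_simps)
qed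

subsection \<open>Cubical complexes and cylinders\<close>

text \<open>The product with \<open>T\<close> stays inside the same type and can therefore be
  iterated: the new coordinate takes index 0 and the old ones move up by one.\<close>

definition cylinder :: "real set \<Rightarrow> (nat \<Rightarrow> real) set \<Rightarrow> (nat \<Rightarrow> real) set" where
  "cylinder T C = {f. f 0 \<in> T \<and> (f \<circ> Suc) \<in> C}"

text \<open>Asking that the faces of a cube be all members of \<open>K\<close> contained in it makes the face
  conditions independent of the charts, which need not be named then.\<close>

definition cubical :: "'a::t2_space set set \<Rightarrow> ('a set \<Rightarrow> nat) \<Rightarrow> bool" where
  "cubical K dm \<longleftrightarrow> finite K \<and>
     (\<forall>C\<in>K. \<exists>h g. homeomorphism (unit_cube (dm C)) C h g \<and> cube_faces (dm C) h = {D \<in> K. D \<subseteq> C}) \<and>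
     (\<forall>C\<in>K. \<forall>D\<in>K. C \<inter> D = {} \<or> C \<inter> D \<in> K)"

lemma cubical_chart:
  assumes "cubical K dm" "C \<in> K"
  obtains h g where "homeomorphism (unit_cube (dm C)) C h g" "cube_faces (dm C) h = {D \<in> K. D \<subseteq> C}"
  using assms unfolding cubical_def by (elim conjE) (drule (1) bspec, elim exE conjE, assumption)

lemma cubical_Int: "cubical K dm \<Longrightarrow> C \<in> K \<Longrightarrow> D \<in> K \<Longrightarrow> C \<inter> D = {} \<or> C \<inter> D \<in> K"
  unfolding cubical_def by simp

lemma cubical_finite: "cubical K dm \<Longrightarrow> finite K"
  unfolding cubical_def by simp

text \<open>A nonempty intersection of two cubes is a member of \<open>K\<close> contained in both,
  hence a face of both whichever charts are chosen.\<close>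

lemma cubical_imp_cube_complex:
  assumes "cubical K dm"
  shows "\<exists>ch. cube_complex K dm ch"
proof -
  have "\<forall>C\<in>K. \<exists>h. (\<exists>g. homeomorphism (unit_cube (dm C)) C h g) \<and> cube_faces (dm C) h = {D \<in> K. D \<subseteq> C}"
  proof
    fix C assume "C \<in> K"
    with assms obtain h g where "homeomorphism (unit_cube (dm C)) C h g" "cube_faces (dm C) h = {D \<in> K. D \<subseteq> C}"
      by (rule cubical_chart)
    then show "\<exists>h. (\<exists>g. homeomorphism (unit_cube (dm C)) C h g) \<and> cube_faces (dm C) h = {D \<in> K. D \<subseteq> C}"
      by blast
  qed
  from bchoice[OF this] obtain ch where ch: "\<And>C. C \<in> K \<Longrightarrow>
      (\<exists>g. homeomorphism (unit_cube (dm C)) C (ch C) g) \<and> cube_faces (dm C) (ch C) = {D \<in> K. D \<subseteq> C}"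
    by auto
  then have "cube_faces (dm C) (ch C) = {D \<in> K. D \<subseteq> C}" if "C \<in> K" for C
    using that by blast
  moreover have "finite K" "\<And>C D. C \<in> K \<Longrightarrow> D \<in> K \<Longrightarrow> C \<inter> D = {} \<or> C \<inter> D \<in> K"
    using cubical_finite[OF assms] cubical_Int[OF assms] by simp_all
  ultimately have "cube_complex K dm ch"
    using ch unfolding cube_complex_def by (simp add: subset_iff)
  then show ?thesis by blast
qed

lemma unit_cube_nonempty: "unit_cube k \<noteq> {}"
  by (simp add: unit_cube_def PiE_eq_empty_iff)

lemma cubical_nonempty:
  assumes "cubical K dm" "C \<in> K"
  shows "C \<noteq> {}"
proof -
  obtain h g where "homeomorphism (unit_cube (dm C)) C h g"
    using assms by (rule cubical_chart)
  then have "h ` unit_cube (dm C) = C" by (rule homeomorphism_image1)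
  then show ?thesis using unit_cube_nonempty[of "dm C"] by blast
qed

section \<open>Faces of the interval, cylinders over sets and their charts\<close>

definition interval_faces :: "real set set" where
  "interval_faces = {{0}, {1}, {0..1}}"

lemma interval_faces_nonempty: "T \<in> interval_faces \<Longrightarrow> T \<noteq> {} \<and> T \<subseteq> {0..1}"
  by (auto simp: interval_faces_def)

lemma interval_faces_Int:
  assumes "T \<in> interval_faces" "T' \<in> interval_faces"
  shows "T \<inter> T' = {} \<or> T \<inter> T' \<in> interval_faces"
proof -
  have "{0, 1} \<subseteq> {0..1::real}" by simp
  with assms show ?thesis unfolding interval_faces_def by blast
qed

lemma interval_faces_subset: "T \<in> interval_faces \<Longrightarrow> T \<subseteq> {c} \<Longrightarrow> T = {c}"
  using interval_faces_nonempty by blast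

lemma unit_cube_faces_eq:
  "unit_cube_faces k = {Pi\<^sub>E {..<k} I | I. \<forall>i<k. I i \<in> interval_faces}"
  by (simp add: unit_cube_faces_def interval_faces_def)

lemma cube_facesI:
  "(\<And>i. i < k \<Longrightarrow> I i \<in> interval_faces) \<Longrightarrow> h ` Pi\<^sub>E {..<k} I \<in> cube_faces k h"
  unfolding cube_faces_def unit_cube_faces_eq by (intro imageI CollectI exI[of _ I]) simp

lemma cube_facesE:
  assumes "X \<in> cube_faces k h"
  obtains I where "\<forall>i<k. I i \<in> interval_faces" "X = h ` Pi\<^sub>E {..<k} I"
  using assms unfolding cube_faces_def unit_cube_faces_eq by auto

lemma case_nat_in_cylinder: "case_nat t x \<in> cylinder T C \<longleftrightarrow> t \<in> T \<and> x \<in> C"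
  by (simp add: cylinder_def comp_def)

lemma case_nat_comp_Suc: "case_nat (f 0) (f \<circ> Suc) = f"
  by (auto simp: comp_def split: nat.splits)

lemma cylinder_eq_image: "cylinder T C = (\<lambda>(t, x). case_nat t x) ` (T \<times> C)"
proof
  show "cylinder T C \<subseteq> (\<lambda>(t, x). case_nat t x) ` (T \<times> C)"
  proof
    fix f assume "f \<in> cylinder T C"
    then show "f \<in> (\<lambda>(t, x). case_nat t x) ` (T \<times> C)"
      by (intro image_eqI[of _ _ "(f 0, f \<circ> Suc)"]) (simp_all add: case_nat_comp_Suc cylinder_def)
  qed
qed (auto simp: case_nat_in_cylinder)

lemma cylinder_image: "cylinder T (h ` F) = (\<lambda>(t, y). case_nat t (h y)) ` (T \<times> F)"
proof -
  have "T \<times> h ` F = (\<lambda>(t, y). (t, h y)) ` (T \<times> F)" by force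
  then show ?thesis unfolding cylinder_eq_image by (simp add: image_image case_prod_unfold)
qed

lemma cylinder_subset_iff:
  assumes "T \<noteq> {}" "C \<noteq> {}"
  shows "cylinder T C \<subseteq> cylinder T' C' \<longleftrightarrow> T \<subseteq> T' \<and> C \<subseteq> C'"
proof
  assume sub: "cylinder T C \<subseteq> cylinder T' C'"
  have "t \<in> T' \<and> x \<in> C'" if "t \<in> T" "x \<in> C" for t x
    using that subsetD[OF sub, of "case_nat t x"] by (simp add: case_nat_in_cylinder)
  then show "T \<subseteq> T' \<and> C \<subseteq> C'" using assms by blast
qed (auto simp: cylinder_def)

lemma cylinder_eq_iff:
  assumes "T \<noteq> {}" "C \<noteq> {}" "T' \<noteq> {}" "C' \<noteq> {}"
  shows "cylinder T C = cylinder T' C' \<longleftrightarrow> T = T' \<and> C = C'"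
  unfolding set_eq_subset cylinder_subset_iff[OF assms(1,2)] cylinder_subset_iff[OF assms(3,4)] by argo

lemma cylinder_Int: "cylinder T C \<inter> cylinder T' C' = cylinder (T \<inter> T') (C \<inter> C')"
  by (auto simp: cylinder_def)

lemma base_cylinder: "T \<noteq> {} \<Longrightarrow> (\<lambda>f. f \<circ> Suc) ` cylinder T C = C"
  by (force simp: cylinder_eq_image image_image comp_def case_prod_unfold)

lemma fibre_cylinder: "C \<noteq> {} \<Longrightarrow> (\<lambda>f. f 0) ` cylinder T C = T"
  by (force simp: cylinder_eq_image image_image case_prod_unfold)

lemma continuous_case_nat:
  assumes "continuous_on S t" "continuous_on S x"
  shows "continuous_on S (\<lambda>z. case_nat (t z) (x z) :: nat \<Rightarrow> real)"
proof (rule continuous_on_coordinatewise_then_product)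
  show "continuous_on S (\<lambda>z. case_nat (t z) (x z) i :: real)" for i
    by (cases i) (simp_all add: assms continuous_on_product_then_coordinatewise)
qed

lemma continuous_comp_Suc: "continuous_on S (\<lambda>f :: nat \<Rightarrow> real. f \<circ> Suc)"
  unfolding comp_def
  by (intro continuous_on_coordinatewise_then_product)
    (rule continuous_on_subset[OF continuous_on_product_coordinates], simp)

lemma homeomorphism_cylinder_point:
  assumes "homeomorphism P C h g"
  shows "homeomorphism P (cylinder {c} C) (\<lambda>x. case_nat c (h x)) (\<lambda>f. g (f \<circ> Suc))"
proof (rule homeomorphismI)
  have hom: "continuous_on P h" "continuous_on C g" "h ` P = C" "g ` C = P"
      "\<And>x. x \<in> P \<Longrightarrow> g (h x) = x" "\<And>y. y \<in> C \<Longrightarrow> h (g y) = y"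
    using assms by (auto simp: homeomorphism_def)
  show "continuous_on P (\<lambda>x. case_nat c (h x))"
    by (intro continuous_case_nat continuous_on_const hom)
  show "continuous_on (cylinder {c} C) (\<lambda>f. g (f \<circ> Suc))"
    by (rule continuous_on_compose2[OF hom(2) continuous_comp_Suc]) (auto simp: cylinder_def)
  show "(\<lambda>x. case_nat c (h x)) ` P \<subseteq> cylinder {c} C"
    using hom(3) by (auto simp: case_nat_in_cylinder)
  show "(\<lambda>f. g (f \<circ> Suc)) ` cylinder {c} C \<subseteq> P"
    using hom(4) by (auto simp: cylinder_def)
  show "g (case_nat c (h x) \<circ> Suc) = x" if "x \<in> P" for x
    using that hom(5) by (simp add: comp_def)
  show "case_nat c (h (g (f \<circ> Suc))) = f" if "f \<in> cylinder {c} C" for f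
    using that hom(6) case_nat_comp_Suc[of f] by (auto simp: cylinder_def)
qed

lemma PiE_lessThan_Suc:
  "x \<in> Pi\<^sub>E {..<Suc k} I \<longleftrightarrow> x k \<in> I k \<and> restrict x {..<k} \<in> Pi\<^sub>E {..<k} I \<and> x \<in> extensional {..<Suc k}"
  by (auto simp: PiE_iff less_Suc_eq)

text \<open>The interval is coordinate 0 of the cylinder but the last coordinate \<open>k\<close> of
  the cube. Dropping the last coordinate leaves an extensional function on \<open>{..<k}\<close>, to
  which \<open>h\<close> applies without any shift of indices.\<close>

lemma homeomorphism_cylinder_interval:
  assumes "homeomorphism (unit_cube k) C h g"
  shows "homeomorphism (unit_cube (Suc k)) (cylinder {0..1} C)
    (\<lambda>x. case_nat (x k) (h (restrict x {..<k}))) (\<lambda>f. (g (f \<circ> Suc))(k := f 0))"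
proof (rule homeomorphismI)
  have hom: "continuous_on (unit_cube k) h" "continuous_on C g" "h ` unit_cube k = C" "g ` C = unit_cube k"
      "\<And>x. x \<in> unit_cube k \<Longrightarrow> g (h x) = x" "\<And>y. y \<in> C \<Longrightarrow> h (g y) = y"
    using assms by (auto simp: homeomorphism_def)
  have res: "restrict x {..<k} \<in> unit_cube k" "x k \<in> {0..1}" if "x \<in> unit_cube (Suc k)" for x
    using that by (auto simp: unit_cube_def PiE_lessThan_Suc)
  have upd: "y(k := t) \<in> unit_cube (Suc k)" if "y \<in> unit_cube k" "t \<in> {0..1}" for y t
    using that by (auto simp: unit_cube_def PiE_iff extensional_def less_Suc_eq)
  have "continuous_on S (\<lambda>x. restrict x {..<k} i)" for S :: "(nat \<Rightarrow> real) set" and i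
    by (cases "i < k")
      (auto simp: restrict_def intro: continuous_on_subset[OF continuous_on_product_coordinates])
  then have cres: "continuous_on S (\<lambda>x. restrict x {..<k})" for S :: "(nat \<Rightarrow> real) set"
    by (intro continuous_on_coordinatewise_then_product)
  show "continuous_on (unit_cube (Suc k)) (\<lambda>x. case_nat (x k) (h (restrict x {..<k})))"
    using res
    by (intro continuous_case_nat continuous_on_compose2[OF hom(1) cres])
      (auto intro: continuous_on_subset[OF continuous_on_product_coordinates])
  have cg: "continuous_on (cylinder {0..1} C) (\<lambda>f. g (f \<circ> Suc))"
    by (rule continuous_on_compose2[OF hom(2) continuous_comp_Suc]) (auto simp: cylinder_def)
  have "continuous_on (cylinder {0..1} C) (\<lambda>f. ((g (f \<circ> Suc))(k := f 0)) i)" for i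
    using continuous_on_product_then_coordinatewise[OF cg, of i]
    by (cases "i = k") (auto intro: continuous_on_subset[OF continuous_on_product_coordinates])
  then show "continuous_on (cylinder {0..1} C) (\<lambda>f. (g (f \<circ> Suc))(k := f 0))"
    by (rule continuous_on_coordinatewise_then_product)
  show "(\<lambda>x. case_nat (x k) (h (restrict x {..<k}))) ` unit_cube (Suc k) \<subseteq> cylinder {0..1} C"
    using hom(3) res by (auto simp: case_nat_in_cylinder)
  show "(\<lambda>f. (g (f \<circ> Suc))(k := f 0)) ` cylinder {0..1} C \<subseteq> unit_cube (Suc k)"
    using hom(4) by (auto simp: cylinder_def intro!: upd)
  show "(g (case_nat (x k) (h (restrict x {..<k})) \<circ> Suc))(k := case_nat (x k) (h (restrict x {..<k})) 0) = x"
    if "x \<in> unit_cube (Suc k)" for x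
  proof -
    have "(restrict x {..<k})(k := x k) = x"
      using that by (auto simp: unit_cube_def PiE_iff extensional_def fun_eq_iff less_Suc_eq)
    then show ?thesis using hom(5)[OF res(1)[OF that]] by (simp add: comp_def)
  qed
  show "case_nat (((g (f \<circ> Suc))(k := f 0)) k) (h (restrict ((g (f \<circ> Suc))(k := f 0)) {..<k})) = f"
    if "f \<in> cylinder {0..1} C" for f
  proof -
    have "f \<circ> Suc \<in> C" using that by (simp add: cylinder_def)
    then have "g (f \<circ> Suc) \<in> unit_cube k" "h (g (f \<circ> Suc)) = f \<circ> Suc" using hom(4,6) by auto
    moreover from this have "restrict (g (f \<circ> Suc)) {..<k} = g (f \<circ> Suc)"
      by (auto simp: unit_cube_def PiE_iff extensional_restrict)
    ultimately show ?thesis by (simp add: case_nat_comp_Suc)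
  qed
qed

lemma cube_faces_cylinder_point:
  "cube_faces k (\<lambda>x. case_nat c (h x)) = cylinder {c} ` cube_faces k h"
proof -
  have "(\<lambda>x. case_nat c (h x)) ` F = cylinder {c} (h ` F)" for F
    unfolding cylinder_eq_image by force
  then show ?thesis unfolding cube_faces_def image_image by simp
qed

text \<open>Faces of the unit cube are boxes. The chart turns the last side of a box into
  \<open>T\<close> and applies \<open>h\<close> to the remaining box, which is a face of the cube of
  dimension \<open>k\<close>.\<close>

lemma cube_faces_cylinder_interval:
  "cube_faces (Suc k) (\<lambda>x. case_nat (x k) (h (restrict x {..<k}))) =
     {cylinder T D | T D. T \<in> interval_faces \<and> D \<in> cube_faces k h}"
proof -
  have im: "(\<lambda>x. case_nat (x k) (h (restrict x {..<k}))) ` Pi\<^sub>E {..<Suc k} I =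
      cylinder (I k) (h ` Pi\<^sub>E {..<k} I)" for I
  proof -
    have "(\<lambda>x. (x k, restrict x {..<k})) ` Pi\<^sub>E {..<Suc k} I = I k \<times> Pi\<^sub>E {..<k} I"
    proof
      show "I k \<times> Pi\<^sub>E {..<k} I \<subseteq> (\<lambda>x. (x k, restrict x {..<k})) ` Pi\<^sub>E {..<Suc k} I"
      proof clarify
        fix t y assume "t \<in> I k" and y: "y \<in> Pi\<^sub>E {..<k} I"
        have "restrict (y(k := t)) {..<k} = y"
          using y by (auto simp: PiE_iff extensional_def)
        moreover have "y(k := t) \<in> extensional {..<Suc k}"
          using y by (auto simp: PiE_iff extensional_def)
        ultimately show "(t, y) \<in> (\<lambda>x. (x k, restrict x {..<k})) ` Pi\<^sub>E {..<Suc k} I"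
          using \<open>t \<in> I k\<close> y by (intro image_eqI[of _ _ "y(k := t)"]) (simp_all add: PiE_lessThan_Suc)
      qed
      show "(\<lambda>x. (x k, restrict x {..<k})) ` Pi\<^sub>E {..<Suc k} I \<subseteq> I k \<times> Pi\<^sub>E {..<k} I"
        using PiE_lessThan_Suc[of _ k I] by blast
    qed
    then have "cylinder (I k) (h ` Pi\<^sub>E {..<k} I) =
        (\<lambda>(t, y). case_nat t (h y)) ` (\<lambda>x. (x k, restrict x {..<k})) ` Pi\<^sub>E {..<Suc k} I"
      unfolding cylinder_image by (rule arg_cong[OF sym])
    then show ?thesis unfolding image_image case_prod_conv by (rule sym)
  qed
  show ?thesis
  proof (intro equalityI subsetI)
    fix X assume "X \<in> cube_faces (Suc k) (\<lambda>x. case_nat (x k) (h (restrict x {..<k})))"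
    then obtain I where "\<forall>i<Suc k. I i \<in> interval_faces" "X = cylinder (I k) (h ` Pi\<^sub>E {..<k} I)"
      unfolding cube_faces_def unit_cube_faces_eq using im by auto
    moreover from this have "h ` Pi\<^sub>E {..<k} I \<in> cube_faces k h"
      unfolding cube_faces_def unit_cube_faces_eq by (blast intro: less_SucI)
    ultimately show "X \<in> {cylinder T D | T D. T \<in> interval_faces \<and> D \<in> cube_faces k h}"
      by blast
  next
    fix X assume "X \<in> {cylinder T D | T D. T \<in> interval_faces \<and> D \<in> cube_faces k h}"
    then obtain T I where T: "T \<in> interval_faces" "\<forall>i<k. I i \<in> interval_faces"
      and X: "X = cylinder T (h ` Pi\<^sub>E {..<k} I)"
      unfolding cube_faces_def unit_cube_faces_eq by auto
    have "Pi\<^sub>E {..<k} (I(k := T)) = Pi\<^sub>E {..<k} I" by (intro PiE_cong) simp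
    then have "X = (\<lambda>x. case_nat (x k) (h (restrict x {..<k}))) ` Pi\<^sub>E {..<Suc k} (I(k := T))"
      unfolding im X by simp
    moreover have "\<forall>i<Suc k. (I(k := T)) i \<in> interval_faces" using T by (simp add: less_Suc_eq)
    ultimately show "X \<in> cube_faces (Suc k) (\<lambda>x. case_nat (x k) (h (restrict x {..<k})))"
      unfolding cube_faces_def unit_cube_faces_eq by blast
  qed
qed

section \<open>The cylinder over a complex\<close>

definition cylinder_complex :: "(nat \<Rightarrow> real) set set \<Rightarrow> (nat \<Rightarrow> real) set set" where
  "cylinder_complex K = (\<lambda>(T, C). cylinder T C) ` (interval_faces \<times> K)"

text \<open>Dimensions are attached to cubes as sets, so the base and the interval factor have to be
  recovered from \<open>X\<close> by projecting.\<close>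

definition cylinder_dim :: "((nat \<Rightarrow> real) set \<Rightarrow> nat) \<Rightarrow> (nat \<Rightarrow> real) set \<Rightarrow> nat" where
  "cylinder_dim dm X = dm ((\<lambda>f. f \<circ> Suc) ` X) + (if (\<lambda>f. f 0) ` X = {0..1} then 1 else 0)"

lemma cylinder_dim_cylinder:
  assumes "T \<noteq> {}" "C \<noteq> {}"
  shows "cylinder_dim dm (cylinder T C) = dm C + (if T = {0..1} then 1 else 0)"
  using assms by (simp add: cylinder_dim_def base_cylinder fibre_cylinder)

lemma cylinder_complexE:
  assumes "X \<in> cylinder_complex K"
  obtains T C where "T \<in> interval_faces" "C \<in> K" "X = cylinder T C"
  using assms unfolding cylinder_complex_def by auto

lemma Union_cylinder_complex: "\<Union>(cylinder_complex K) = cylinder {0..1} (\<Union>K)"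
proof
  have "cylinder T C \<subseteq> cylinder {0..1} (\<Union>K)" if "T \<in> interval_faces" "C \<in> K" for T C
    using that interval_faces_nonempty[of T] unfolding cylinder_def by blast
  then show "\<Union>(cylinder_complex K) \<subseteq> cylinder {0..1} (\<Union>K)"
    unfolding cylinder_complex_def by blast
  have "f \<in> cylinder {0..1} C" if "f \<in> cylinder {0..1} (\<Union>K)" "f \<circ> Suc \<in> C" for f C
    using that by (simp add: cylinder_def)
  moreover have "{0..1} \<in> interval_faces" by (simp add: interval_faces_def)
  ultimately show "cylinder {0..1} (\<Union>K) \<subseteq> \<Union>(cylinder_complex K)"
    unfolding cylinder_complex_def by (auto simp: cylinder_def)
qed

text \<open>Nonempty cylinders are ordered by inclusion exactly as the pairs \<open>(T, C)\<close>,
  and intersections are taken in each factor. So the members of the complex inside a cylinder are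
  the products of a face of \<open>T\<close> and a face of \<open>C\<close>, which are the faces
  given by its chart.\<close>

lemma cubical_cylinder:
  assumes K: "cubical K dm"
  shows "cubical (cylinder_complex K) (cylinder_dim dm)"
  unfolding cubical_def
proof (intro conjI ballI)
  note ne = cubical_nonempty[OF K] interval_faces_nonempty
  show "finite (cylinder_complex K)"
    using cubical_finite[OF K] by (simp add: cylinder_complex_def interval_faces_def)
  show "X \<inter> Y = {} \<or> X \<inter> Y \<in> cylinder_complex K"
    if XY: "X \<in> cylinder_complex K" "Y \<in> cylinder_complex K" for X Y
  proof -
    obtain T C where X: "T \<in> interval_faces" "C \<in> K" "X = cylinder T C"
      using XY(1) by (rule cylinder_complexE)
    obtain T' C' where Y: "T' \<in> interval_faces" "C' \<in> K" "Y = cylinder T' C'"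
      using XY(2) by (rule cylinder_complexE)
    have XY: "X \<inter> Y = cylinder (T \<inter> T') (C \<inter> C')" by (simp add: X Y cylinder_Int)
    consider "C \<inter> C' = {} \<or> T \<inter> T' = {}" | "C \<inter> C' \<in> K" "T \<inter> T' \<in> interval_faces"
      using cubical_Int[OF K X(2) Y(2)] interval_faces_Int[OF X(1) Y(1)] by blast
    then show ?thesis
    proof cases
      case 1
      then have "X \<inter> Y = {}" unfolding XY by (auto simp: cylinder_def)
      then show ?thesis ..
    next
      case 2
      then have "X \<inter> Y \<in> cylinder_complex K" unfolding XY cylinder_complex_def by blast
      then show ?thesis ..
    qed
  qed
  show "\<exists>h g. homeomorphism (unit_cube (cylinder_dim dm X)) X h g \<and>
      cube_faces (cylinder_dim dm X) h = {Y \<in> cylinder_complex K. Y \<subseteq> X}"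
    if X: "X \<in> cylinder_complex K" for X
  proof -
    obtain T C where T: "T \<in> interval_faces" and C: "C \<in> K" and XTC: "X = cylinder T C"
      using X by (rule cylinder_complexE)
    obtain h g where hom: "homeomorphism (unit_cube (dm C)) C h g"
      and faces: "cube_faces (dm C) h = {D \<in> K. D \<subseteq> C}"
      using K C by (rule cubical_chart)
    have sub: "{Y \<in> cylinder_complex K. Y \<subseteq> X} =
        {cylinder T' D | T' D. T' \<in> interval_faces \<and> T' \<subseteq> T \<and> D \<in> cube_faces (dm C) h}"
    proof -
      have "cylinder T' D \<subseteq> cylinder T C \<longleftrightarrow> T' \<subseteq> T \<and> D \<subseteq> C" if "T' \<in> interval_faces" "D \<in> K" for T' D
        using ne that by (intro cylinder_subset_iff) blast+
      note sub_iff = this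
      show ?thesis
      proof (intro equalityI subsetI)
        fix Y assume Y: "Y \<in> {Y \<in> cylinder_complex K. Y \<subseteq> X}"
        then obtain T' D where "T' \<in> interval_faces" "D \<in> K" "Y = cylinder T' D"
          by (blast elim: cylinder_complexE)
        with Y sub_iff[of T' D]
        show "Y \<in> {cylinder T' D | T' D. T' \<in> interval_faces \<and> T' \<subseteq> T \<and> D \<in> cube_faces (dm C) h}"
          unfolding faces XTC by blast
      next
        fix Y assume "Y \<in> {cylinder T' D | T' D. T' \<in> interval_faces \<and> T' \<subseteq> T \<and> D \<in> cube_faces (dm C) h}"
        then obtain T' D where "T' \<in> interval_faces" "T' \<subseteq> T" "D \<in> K" "D \<subseteq> C" "Y = cylinder T' D"
          unfolding faces by blast
        then show "Y \<in> {Y \<in> cylinder_complex K. Y \<subseteq> X}"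
          unfolding XTC cylinder_complex_def using sub_iff[of T' D] by auto
      qed
    qed
    have dim: "cylinder_dim dm X = dm C + (if T = {0..1} then 1 else 0)"
      unfolding XTC using ne T C by (intro cylinder_dim_cylinder) blast+
    show ?thesis
    proof (cases "T = {0..1}")
      case True
      have "{Y \<in> cylinder_complex K. Y \<subseteq> X} =
          {cylinder T' D | T' D. T' \<in> interval_faces \<and> D \<in> cube_faces (dm C) h}"
        unfolding sub True using interval_faces_nonempty by blast
      then have "cube_faces (Suc (dm C)) (\<lambda>x. case_nat (x (dm C)) (h (restrict x {..<dm C}))) =
          {Y \<in> cylinder_complex K. Y \<subseteq> X}"
        unfolding cube_faces_cylinder_interval by (rule sym)
      moreover have "cylinder_dim dm X = Suc (dm C)" using dim True by simp
      ultimately show ?thesis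
        using homeomorphism_cylinder_interval[OF hom] unfolding XTC True by (intro exI conjI) simp_all
    next
      case False
      then obtain c where c: "T = {c}" using T by (auto simp: interval_faces_def)
      have "{Y \<in> cylinder_complex K. Y \<subseteq> X} = cylinder {c} ` cube_faces (dm C) h"
        unfolding sub c using interval_faces_subset T c by blast
      then have "cube_faces (dm C) (\<lambda>x. case_nat c (h x)) = {Y \<in> cylinder_complex K. Y \<subseteq> X}"
        unfolding cube_faces_cylinder_point by (rule sym)
      moreover have "cylinder_dim dm X = dm C" using dim False by simp
      ultimately show ?thesis
        using homeomorphism_cylinder_point[OF hom, of c] unfolding XTC c by (intro exI conjI) simp_all
    qed
  qed
qed

lemma cylinder_complex_counts:
  assumes K: "cubical K dm" and d: "has_dimension K dm d"
  shows "has_dimension (cylinder_complex K) (cylinder_dim dm) (Suc d)"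
    and "card (vertices (cylinder_complex K) (cylinder_dim dm)) \<le> 2 * card (vertices K dm)"
    and "card (cubes_of_dim K dm d) \<le> card (cubes_of_dim (cylinder_complex K) (cylinder_dim dm) (Suc d))"
proof -
  note ne = cubical_nonempty[OF K] interval_faces_nonempty
  have fin: "finite K" "finite (cylinder_complex K)"
    using cubical_finite[OF K] cubical_finite[OF cubical_cylinder[OF K]] by simp_all
  have dim: "cylinder_dim dm (cylinder T C) = dm C + (if T = {0..1} then 1 else 0)"
    if "T \<in> interval_faces" "C \<in> K" for T C
    using ne that by (intro cylinder_dim_cylinder) blast+
  have I: "{0..1} \<in> interval_faces" by (simp add: interval_faces_def)
  obtain C0 where C0: "C0 \<in> K" "dm C0 = d" and le: "\<And>C. C \<in> K \<Longrightarrow> dm C \<le> d"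
    using d unfolding has_dimension_def by blast
  show "has_dimension (cylinder_complex K) (cylinder_dim dm) (Suc d)"
    unfolding has_dimension_def
  proof (intro conjI ballI bexI)
    show "cylinder_dim dm X \<le> Suc d" if X: "X \<in> cylinder_complex K" for X
    proof -
      obtain T C where "T \<in> interval_faces" "C \<in> K" "X = cylinder T C"
        using X by (rule cylinder_complexE)
      then show ?thesis using dim[of T C] le[of C] by simp
    qed
    show "cylinder_dim dm (cylinder {0..1} C0) = Suc d" using dim[OF I C0(1)] C0(2) by simp
    show "cylinder {0..1} C0 \<in> cylinder_complex K"
      using I C0 by (auto simp: cylinder_complex_def)
  qed
  have finV: "finite (vertices K dm)" using fin by (simp add: cubes_of_dim_def)
  have "vertices (cylinder_complex K) (cylinder_dim dm) \<subseteq>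
      cylinder {0} ` vertices K dm \<union> cylinder {1} ` vertices K dm"
  proof
    fix X assume X: "X \<in> vertices (cylinder_complex K) (cylinder_dim dm)"
    then obtain T C where "T \<in> interval_faces" "C \<in> K" "X = cylinder T C" "cylinder_dim dm X = 0"
      by (auto simp: cubes_of_dim_def cylinder_complex_def)
    then show "X \<in> cylinder {0} ` vertices K dm \<union> cylinder {1} ` vertices K dm"
      using dim[of T C] by (auto simp: cubes_of_dim_def interval_faces_def split: if_splits)
  qed
  then have "card (vertices (cylinder_complex K) (cylinder_dim dm)) \<le>
      card (cylinder {0} ` vertices K dm \<union> cylinder {1} ` vertices K dm)"
    using finV by (intro card_mono) auto
  also have "\<dots> \<le> card (vertices K dm) + card (vertices K dm)"
    using card_Un_le card_image_le[OF finV, of "cylinder {0}"] card_image_le[OF finV, of "cylinder {1}"]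
    by (rule order_trans[OF _ add_mono])
  finally show "card (vertices (cylinder_complex K) (cylinder_dim dm)) \<le> 2 * card (vertices K dm)"
    by simp
  show "card (cubes_of_dim K dm d) \<le> card (cubes_of_dim (cylinder_complex K) (cylinder_dim dm) (Suc d))"
  proof (rule card_inj_on_le)
    show "inj_on (cylinder {0..1}) (cubes_of_dim K dm d)"
      using ne cylinder_eq_iff[of "{0..1}" _ "{0..1}"] by (auto simp: inj_on_def cubes_of_dim_def)
    show "cylinder {0..1} ` cubes_of_dim K dm d \<subseteq>
        cubes_of_dim (cylinder_complex K) (cylinder_dim dm) (Suc d)"
      using I dim[OF I] by (auto simp: cubes_of_dim_def cylinder_complex_def)
    show "finite (cubes_of_dim (cylinder_complex K) (cylinder_dim dm) (Suc d))"
      using fin by (simp add: cubes_of_dim_def)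
  qed
qed

subsection \<open>Contractible spaces\<close>

text \<open>Following a loop by the contraction moves it through loops to a constant one, and any
  two loops meet there. Only the topology is used, since the ambient space
  \<open>nat \<Rightarrow> real\<close> carries no norm.\<close>

lemma contractible_imp_simply_connected_space:
  fixes S :: "'a::topological_space set"
  assumes "contractible S"
  shows "simply_connected S"
proof -
  obtain a where a: "homotopic_with_canon (\<lambda>x. True) S S id (\<lambda>x. a)"
    using assms unfolding contractible_def by blast
  have "homotopic_loops S p (\<lambda>x. a)"
    if p: "path p" "pathfinish p = pathstart p" "path_image p \<subseteq> S" for p
  proof -
    have "homotopic_with_canon (\<lambda>r. pathfinish r = pathstart r) {0..1} S (id \<circ> p) ((\<lambda>x. a) \<circ> p)"
      using a
    proof (rule homotopic_with_compose_continuous_map_right)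
      show "continuous_map (top_of_set {0..1}) (top_of_set S) p"
        using p by (auto simp: path_def path_image_def)
      show "pathfinish (j \<circ> p) = pathstart (j \<circ> p)" for j :: "'a \<Rightarrow> 'a"
        using p by (simp add: pathfinish_def pathstart_def)
    qed
    then show ?thesis
      unfolding homotopic_loops_def by (simp add: comp_def)
  qed
  then show ?thesis
    unfolding simply_connected_def by (meson homotopic_loops_sym homotopic_loops_trans)
qed

text \<open>The topological form of an elementary collapse. In the convex model \<open>P\<close> the
  straight line from \<open>x\<close> to \<open>r x\<close> deforms the identity into
  \<open>r\<close> and does not move \<open>A\<close>. Carried over by the chart, it fits together
  with the identity of \<open>X\<close> and pushes \<open>C\<close> into \<open>X\<close>, where the
  given contraction takes over.\<close>

lemma contractible_Un_collapse:
  fixes X :: "'a::t2_space set" and P :: "'b::real_normed_vector set"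
  assumes X: "contractible X" and cl: "closed X" "closed C" and P: "convex P"
    and hom: "homeomorphism P C h g" and r: "retraction P A r" and XC: "X \<inter> C = h ` A"
  shows "contractible (X \<union> C)"
proof -
  have A: "A \<subseteq> P" and conr: "continuous_on P r" and rA: "r \<in> P \<rightarrow> A" and rid: "\<And>x. x \<in> A \<Longrightarrow> r x = x"
    using r by (auto simp: retraction_def)
  have h: "continuous_on P h" "h ` P = C" and g: "continuous_on C g" "g ` C = P"
    and hg: "\<And>c. c \<in> C \<Longrightarrow> h (g c) = c" and gh: "\<And>x. x \<in> P \<Longrightarrow> g (h x) = x"
    using hom by (auto simp: homeomorphism_def)
  have gA: "g c \<in> A" if "c \<in> X" "c \<in> C" for c
    using that XC gh A by (metis IntI imageE subsetD)
  \<comment> \<open>\<open>\<phi>\<close> is the straight-line homotopy, read in \<open>P\<close>;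
    \<open>\<rho>\<close> is the resulting map of the union into \<open>X\<close>.\<close>
  define \<rho> where "\<rho> = (\<lambda>c. if c \<in> X then c else h (r (g c)))"
  define \<phi> where "\<phi> = (\<lambda>(t, c). (1 - t) *\<^sub>R g c + t *\<^sub>R r (g c))"
  have \<phi>P: "\<phi> (t, c) \<in> P" if "t \<in> {0..1}" "c \<in> C" for t c
  proof -
    have "g c \<in> P" "r (g c) \<in> P" using that g rA A by auto
    then have "(1 - t) *\<^sub>R g c + t *\<^sub>R r (g c) \<in> P"
      using that by (intro convexD[OF P]) simp_all
    then show ?thesis by (simp add: \<phi>_def)
  qed
  have cont_rg: "continuous_on C (\<lambda>c. r (g c))"
    using continuous_on_compose2[OF conr g(1)] g(2) by blast
  have cont_\<phi>: "continuous_on ({0..1} \<times> C) \<phi>"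
    unfolding \<phi>_def case_prod_unfold
    by (intro continuous_intros continuous_on_compose2[OF g(1)] continuous_on_compose2[OF cont_rg]) auto
  then have cont_h\<phi>: "continuous_on ({0..1} \<times> C) (\<lambda>z. h (\<phi> z))"
    using \<phi>P by (intro continuous_on_compose2[OF h(1)]) auto
  \<comment> \<open>On the overlap of \<open>X\<close> and \<open>C\<close> both branches are the
    identity because \<open>r\<close> fixes \<open>A\<close>; closedness of the two pieces then
    makes the pasted map continuous.\<close>
  define H where "H = (\<lambda>z. if z \<in> UNIV \<times> X then snd z else h (\<phi> z))"
  have contH: "continuous_on (({0..1} \<times> X) \<union> ({0..1} \<times> C)) H"
    unfolding H_def
  proof (rule continuous_on_cases_local)
    show "closedin (top_of_set ({0..1} \<times> X \<union> {0..1} \<times> C)) ({0..1::real} \<times> X)"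
         "closedin (top_of_set ({0..1} \<times> X \<union> {0..1} \<times> C)) ({0..1::real} \<times> C)"
      using cl by (auto intro!: closed_subset closed_Times)
    show "continuous_on ({0..1} \<times> X) snd" by (rule continuous_on_snd[OF continuous_on_id])
    show "snd z = h (\<phi> z)"
      if z: "z \<in> {0..1} \<times> X \<and> z \<notin> UNIV \<times> X \<or> z \<in> {0..1} \<times> C \<and> z \<in> UNIV \<times> X" for z
    proof -
      have c: "snd z \<in> X" "snd z \<in> C" using z by auto
      then have "\<phi> z = g (snd z)"
        using rid[OF gA[OF c]] by (simp add: \<phi>_def case_prod_unfold flip: scaleR_left_distrib)
      then show ?thesis using hg c by simp
    qed
  qed (use cont_h\<phi> in auto)
  have HX: "H z \<in> X \<union> C" if "z \<in> {0..1} \<times> (X \<union> C)" for z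
  proof (cases "snd z \<in> X")
    case False
    then have "h (\<phi> z) \<in> C" using that \<phi>P[of "fst z" "snd z"] h(2) by (auto simp: mem_Times_iff)
    then show ?thesis using False by (simp add: H_def mem_Times_iff)
  qed (simp add: H_def mem_Times_iff)
  have "homotopic_with_canon (\<lambda>x. True) (X \<union> C) (X \<union> C) id \<rho>"
  proof (subst homotopic_with, simp, intro exI[of _ H] conjI allI ballI)
    show "continuous_map (prod_topology (top_of_set {0..1}) (top_of_set (X \<union> C))) (top_of_set (X \<union> C)) H"
      using contH HX by (simp add: Sigma_Un_distrib2[symmetric] image_subset_iff_funcset[symmetric] image_subset_iff)
    show "H (0, c) = id c" if "c \<in> topspace (top_of_set (X \<union> C))" for c
      using that hg[of c] by (cases "c \<in> X") (simp_all add: H_def \<phi>_def)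
    show "H (1, c) = \<rho> c" for c by (simp add: H_def \<rho>_def \<phi>_def)
  qed simp_all
  moreover
  obtain a where "homotopic_with_canon (\<lambda>x. True) X X id (\<lambda>x. a)"
    using X unfolding contractible_def by blast
  then have "homotopic_with_canon (\<lambda>x. True) (X \<union> C) X (id \<circ> \<rho>) ((\<lambda>x. a) \<circ> \<rho>)"
  proof (rule homotopic_with_compose_continuous_right)
    show "continuous_on (X \<union> C) \<rho>"
      unfolding \<rho>_def
    proof (rule continuous_on_cases_local)
      show "closedin (top_of_set (X \<union> C)) X" "closedin (top_of_set (X \<union> C)) C"
        using cl by (auto intro!: closed_subset)
      show "continuous_on C (\<lambda>c. h (r (g c)))"
        using rA A g(2) by (intro continuous_on_compose2[OF h(1) cont_rg]) auto
      show "c = h (r (g c))" if "c \<in> X \<and> c \<notin> X \<or> c \<in> C \<and> c \<in> X" for c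
        using that gA rid hg by auto
    qed (rule continuous_on_id)
    show "\<rho> \<in> X \<union> C \<rightarrow> X"
    proof
      fix c assume c: "c \<in> X \<union> C"
      show "\<rho> c \<in> X"
      proof (cases "c \<in> X")
        case False
        then have "r (g c) \<in> A" using c g(2) rA by blast
        then show ?thesis using XC False by (auto simp: \<rho>_def)
      qed (simp add: \<rho>_def)
    qed
  qed
  then have "homotopic_with_canon (\<lambda>x. True) (X \<union> C) (X \<union> C) \<rho> (\<lambda>x. a)"
    by (auto simp: comp_def intro: homotopic_with_subset_right)
  ultimately show ?thesis
    unfolding contractible_def by (blast intro: homotopic_with_trans)
qed

text \<open>\<open>A\<close> consists of three sides; the side \<open>fst z = 0\<close> is the free
  one. The function \<open>M\<close> is the gauge of the rectangle \<open>[-3, 1] x [0, 1]\<close>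
  about its centre, from which the projection is taken. Dividing the displacement from the centre by
  \<open>M\<close> reaches the boundary of the rectangle, and points of the unit square land on the
  three sides in \<open>A\<close>, where \<open>M\<close> is 1.\<close>

lemma unit_square_retraction:
  defines "A \<equiv> {z :: real \<times> real. z \<in> {0..1} \<times> {0..1} \<and> (snd z = 0 \<or> fst z = 1 \<or> snd z = 1)}"
  obtains r where "retraction ({0..1} \<times> {0..1}) A r"
proof
  \<comment> \<open>radial projection from the point \<open>(-1, 1/2)\<close>\<close>
  define M where "M = (\<lambda>z :: real \<times> real. max \<bar>2 * snd z - 1\<bar> ((1 + fst z) / 2))"
  define r where "r = (\<lambda>z. ((1 + fst z) / M z - 1, 1 / 2 + (snd z - 1 / 2) / M z))"
  have M: "M z > 0" if "fst z \<ge> 0" for z using that by (auto simp: M_def less_max_iff_disj)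
  have "r z \<in> A" if z: "fst z \<in> {0..1}" "snd z \<in> {0..1}" for z
  proof -
    have pos: "M z > 0" using M z by auto
    have le: "1 + fst z \<le> 2 * M z" "\<bar>2 * snd z - 1\<bar> \<le> M z" "M z \<le> 1"
      using z unfolding M_def by (auto simp: max_def field_simps)
    have 1: "fst (r z) \<in> {0..1}" using le pos z by (auto simp: r_def field_simps)
    have "\<bar>(snd z - 1 / 2) / M z\<bar> \<le> 1 / 2"
      using le pos by (simp add: abs_div field_simps)
    then have "(snd z - 1 / 2) / M z \<le> 1 / 2" "- (1 / 2) \<le> (snd z - 1 / 2) / M z"
      by (simp_all only: abs_le_iff minus_le_iff)
    then have 2: "snd (r z) \<in> {0..1}" unfolding r_def snd_conv atLeastAtMost_iff by linarith
    consider "M z = (1 + fst z) / 2" | "M z = 2 * snd z - 1" | "M z = 1 - 2 * snd z"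
      unfolding M_def by linarith
    then have "snd (r z) = 0 \<or> fst (r z) = 1 \<or> snd (r z) = 1"
    proof cases
      case 1
      then have "fst (r z) = 1" using pos z by (simp add: r_def field_simps)
      then show ?thesis by simp
    next
      case 2
      then have "snd (r z) = 1" using pos by (simp add: r_def field_simps)
      then show ?thesis by simp
    next
      case 3
      then have "snd (r z) = 0" using pos by (simp add: r_def field_simps)
      then show ?thesis by simp
    qed
    with 1 2 show ?thesis by (simp add: A_def mem_Times_iff)
  qed
  moreover have "r z = z" if "z \<in> A" for z
  proof -
    have "M z = 1" using that by (auto simp: A_def M_def)
    then show ?thesis by (simp add: r_def)
  qed
  moreover have "continuous_on ({0..1} \<times> {0..1}) r"
  proof -
    have "continuous_on ({0..1} \<times> {0..1}) M"
      unfolding M_def by (intro continuous_intros) simp_all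
    moreover have "\<forall>z \<in> {0..1} \<times> {0..1}. M z \<noteq> 0"
    proof
      fix z :: "real \<times> real" assume "z \<in> {0..1} \<times> {0..1}"
      then have "M z > 0" by (intro M) (simp add: mem_Times_iff)
      then show "M z \<noteq> 0" by simp
    qed
    ultimately show ?thesis
      unfolding r_def
      by (intro continuous_on_Pair continuous_on_diff continuous_on_add continuous_on_divide
          continuous_on_const continuous_on_fst continuous_on_snd continuous_on_id)
  qed
  moreover have "A \<subseteq> {0..1} \<times> {0..1}" unfolding A_def by blast
  ultimately show "retraction ({0..1} \<times> {0..1}) A r"
    by (simp add: retraction_def Pi_iff mem_Times_iff)
qed

lemma contractible_cylinder:
  assumes "contractible S"
  shows "contractible (cylinder {0..1} S)"
proof -
  let ?f = "\<lambda>z :: real \<times> (nat \<Rightarrow> real). case_nat (fst z) (snd z)"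
  let ?g = "\<lambda>f :: nat \<Rightarrow> real. (f 0, f \<circ> Suc)"
  have gf: "?g (?f z) = z" for z by (simp add: comp_def)
  have fg: "?f (?g f) = f" for f by (auto simp: comp_def split: nat.splits)
  have f: "continuous_on UNIV ?f"
  proof (rule continuous_on_coordinatewise_then_product)
    show "continuous_on UNIV (\<lambda>z :: real \<times> (nat \<Rightarrow> real). case_nat (fst z) (snd z) i)" for i
      by (cases i) (simp_all add: continuous_on_fst continuous_on_product_then_coordinatewise[OF continuous_on_snd])
  qed
  have g: "continuous_on UNIV ?g"
    unfolding comp_def
    by (intro continuous_on_Pair continuous_on_coordinatewise_then_product continuous_on_product_coordinates)
  have "?f z \<in> cylinder {0..1} S \<longleftrightarrow> z \<in> {0..1} \<times> S" for z
    by (simp add: cylinder_def comp_def mem_Times_iff)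
  then have maps: "?f \<in> {0..1} \<times> S \<rightarrow> cylinder {0..1} S" by blast
  have mapsg: "?g \<in> cylinder {0..1} S \<rightarrow> {0..1} \<times> S" by (simp add: cylinder_def)
  have "homeomorphic_maps (top_of_set ({0..1} \<times> S)) (top_of_set (cylinder {0..1} S)) ?f ?g"
    unfolding homeomorphic_maps_def continuous_map_subtopology_eu image_subset_iff_funcset[symmetric]
    using f g maps mapsg fg gf continuous_on_subset[OF f] continuous_on_subset[OF g]
    by (simp add: image_subset_iff_funcset)
  then have "homeomorphic_maps (prod_topology (top_of_set {0..1}) (top_of_set S)) (top_of_set (cylinder {0..1} S)) ?f ?g"
    by simp
  then have "(prod_topology (top_of_set {0..1::real}) (top_of_set S)) homeomorphic_space (top_of_set (cylinder {0..1} S))"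
    unfolding homeomorphic_space_def by blast
  moreover have "contractible_space (prod_topology (top_of_set {0..1::real}) (top_of_set S))"
    using assms convex_imp_contractible[of "{0..1::real}"] by (simp only: contractible_space_prod_topology contractible_space_top_of_set) simp
  ultimately show ?thesis
    using homeomorphic_space_contractibility contractible_space_top_of_set by blast
qed

subsection \<open>Realising the square complexes\<close>

text \<open>The points of a cell are convex weights on its vertices. For a square they are the products of
  the weights of two points of \<open>[0,1]\<close>, and these are singled out by the equation between the products
  along the diagonals. Edges and vertices are cut out of a square by the vanishing of weights.\<close>

definition cell :: "nat set \<Rightarrow> nat set \<Rightarrow> (nat \<Rightarrow> real) set" where
  "cell I J = {f. (\<forall>n. 0 \<le> f n) \<and> (\<forall>n. n \<notin> I \<union> J \<longrightarrow> f n = 0) \<and> sum f (I \<union> J) = 1 \<and>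
     (card I = 2 \<longrightarrow> card J = 2 \<longrightarrow> prod f I = prod f J)}"

definition cells :: "'a set \<Rightarrow> 'a set \<Rightarrow> ('a \<times> 'a) set \<Rightarrow> ('a set \<times> 'a set) set \<Rightarrow> ('a set \<times> 'a set) set" where
  "cells U B E Q = {({i}, {}) | i. i \<in> U} \<union> {({}, {j}) | j. j \<in> B} \<union> {({i}, {j}) | i j. (i, j) \<in> E} \<union> Q"

definition cell_shape :: "'a set \<Rightarrow> 'a set \<Rightarrow> bool" where
  "cell_shape I J \<longleftrightarrow> finite I \<and> finite J \<and> I \<union> J \<noteq> {} \<and>
     (card I \<le> 1 \<and> card J \<le> 1 \<or> card I = 2 \<and> card J = 2)"

lemma cells_cases:
  assumes "(I, J) \<in> cells U B E Q"
  obtains i where "I = {i}" "J = {}" "i \<in> U" | j where "I = {}" "J = {j}" "j \<in> B"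
    | i j where "I = {i}" "J = {j}" "(i, j) \<in> E" | "(I, J) \<in> Q"
  using assms unfolding cells_def by blast

lemma cells_shape:
  assumes b: "built U B E Q" and "(I, J) \<in> cells U B E Q"
  shows "I \<subseteq> U" "J \<subseteq> B" "cell_shape I J" "I \<times> J \<subseteq> E"
proof -
  note wf = built_wf[OF b]
  have "I \<subseteq> U \<and> J \<subseteq> B \<and> cell_shape I J \<and> I \<times> J \<subseteq> E"
    using assms(2)
  proof (cases rule: cells_cases)
    case 4
    have sq: "card I = 2" "card J = 2" "I \<times> J \<subseteq> E"
      using built_square_edges[OF b 4] by simp_all
    then have "finite I" "finite J" by (simp_all add: card_ge_0_finite)
    moreover have "I \<noteq> {}" using sq by auto
    moreover have "I \<subseteq> U" "J \<subseteq> B" using wf 4 by blast+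
    ultimately show ?thesis using sq unfolding cell_shape_def by simp
  qed (use wf in \<open>auto simp: cell_shape_def\<close>)
  then show "I \<subseteq> U" "J \<subseteq> B" "cell_shape I J" "I \<times> J \<subseteq> E" by simp_all
qed

lemma card_le_1_cases:
  assumes "finite I" "card I \<le> 1"
  shows "I = {} \<or> (\<exists>i. I = {i})"
  using assms by (metis One_nat_def card_0_eq card_1_singletonE le_SucE le_zero_eq)

text \<open>At most one vertex of each colour leaves a vertex or a pair \<open>(i, j)\<close>, and
  such a pair is an edge because all of \<open>I \<times> J\<close> lies in
  \<open>E\<close>.\<close>

lemma cells_downward:
  assumes b: "built U B E Q" and c: "(I, J) \<in> cells U B E Q"
    and sub: "I' \<subseteq> I" "J' \<subseteq> J" and card: "card I' \<le> 1" "card J' \<le> 1" and ne: "I' \<union> J' \<noteq> {}"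
  shows "(I', J') \<in> cells U B E Q"
proof -
  note sh = cells_shape[OF b c]
  have fin: "finite I'" "finite J'" using sh(3) sub unfolding cell_shape_def by (auto intro: finite_subset)
  have "I' = {} \<or> (\<exists>i. I' = {i})" "J' = {} \<or> (\<exists>j. J' = {j})"
    using card_le_1_cases[OF fin(1) card(1)] card_le_1_cases[OF fin(2) card(2)] by simp_all
  moreover have "I' \<subseteq> U" "J' \<subseteq> B" "I' \<times> J' \<subseteq> E" using sh sub by blast+
  ultimately show ?thesis using ne by (elim disjE exE) (simp_all add: cells_def)
qed

lemma cells_card_2:
  "(I, J) \<in> cells U B E Q \<Longrightarrow> card I = 2 \<or> card J = 2 \<Longrightarrow> (I, J) \<in> Q"
  by (erule cells_cases) auto

lemma card_Int_2:
  assumes "finite I" "finite I'" "card I \<le> 2" "card I' \<le> 2" "\<not> card (I \<inter> I') \<le> 1"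
  shows "I = I'" "card I = 2"
proof -
  have "card (I \<inter> I') \<le> card I" "card (I \<inter> I') \<le> card I'" using assms by (auto intro: card_mono)
  then have "card (I \<inter> I') = card I" "card (I \<inter> I') = card I'" and 2: "card I = 2" using assms by linarith+
  then have "I \<inter> I' = I" "I \<inter> I' = I'" using assms(1,2) by (simp_all add: card_subset_eq)
  then show "I = I'" "card I = 2" using 2 by auto
qed

text \<open>Two cells with two common vertices of one colour would be squares with a common
  diagonal, and so equal. This is what the freshness of diagonals is for.\<close>

lemma cells_Int:
  assumes b: "built U B E Q" and c: "(I, J) \<in> cells U B E Q" "(I', J') \<in> cells U B E Q"
    and ne: "(I, J) \<noteq> (I', J')"
  shows "card (I \<inter> I') \<le> 1" "card (J \<inter> J') \<le> 1"
proof -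
  have sh: "finite I" "finite I'" "finite J" "finite J'" "card I \<le> 2" "card I' \<le> 2" "card J \<le> 2" "card J' \<le> 2"
    using cells_shape(3)[OF b c(1)] cells_shape(3)[OF b c(2)] unfolding cell_shape_def by auto
  have inj: "inj_on fst Q" "inj_on snd Q" using built_inj_diagonals[OF b] by simp_all
  show "card (I \<inter> I') \<le> 1"
  proof (rule ccontr)
    assume "\<not> ?thesis"
    then have eq: "I = I'" "card I = 2" using card_Int_2[OF sh(1,2,5,6)] by simp_all
    then have "(I, J) \<in> Q" "(I', J') \<in> Q" using cells_card_2 c by metis+
    then show False using inj_onD[OF inj(1), of "(I, J)" "(I', J')"] eq(1) ne by simp
  qed
  show "card (J \<inter> J') \<le> 1"
  proof (rule ccontr)
    assume "\<not> ?thesis"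
    then have eq: "J = J'" "card J = 2" using card_Int_2[OF sh(3,4,7,8)] by simp_all
    then have "(I, J) \<in> Q" "(I', J') \<in> Q" using cells_card_2 c by metis+
    then show False using inj_onD[OF inj(2), of "(I, J)" "(I', J')"] eq(1) ne by simp
  qed
qed

section \<open>Inclusions and intersections of cells, read off from supports\<close>

lemma cellD:
  assumes "f \<in> cell I J"
  shows "0 \<le> f n" "n \<notin> I \<union> J \<Longrightarrow> f n = 0" "sum f (I \<union> J) = 1"
    "card I = 2 \<Longrightarrow> card J = 2 \<Longrightarrow> prod f I = prod f J"
  using assms unfolding cell_def by simp_all

text \<open>Only the product equation of a square needs an argument: a point supported on at most
  one vertex of each colour has a vanishing weight on either diagonal, so both products are
  zero.\<close>

lemma cell_mono:
  assumes fin: "finite I" "finite J" and disj: "I \<inter> J = {}"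
    and sub: "I' \<subseteq> I" "J' \<subseteq> J" and card: "card I' \<le> 1" "card J' \<le> 1"
  shows "cell I' J' \<subseteq> cell I J"
proof
  fix f assume f: "f \<in> cell I' J'"
  have fin': "finite I'" "finite J'" using fin sub finite_subset by blast+
  have supp: "f n = 0" if "n \<notin> I' \<union> J'" for n using cellD(2)[OF f that] .
  have "sum f (I' \<union> J') = sum f (I \<union> J)"
    using fin sub supp by (intro sum.mono_neutral_left) auto
  moreover have "prod f I = prod f J" if 2: "card I = 2" "card J = 2"
  proof -
    have "\<not> I \<subseteq> I'" using card_mono[OF fin'(1), of I] 2 card by auto
    then obtain i where "i \<in> I" "i \<notin> I'" by blast
    moreover from this have "f i = 0" using disj sub by (intro supp) blast
    ultimately have "prod f I = 0" using fin by (auto simp: prod_zero_iff)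
    have "\<not> J \<subseteq> J'" using card_mono[OF fin'(2), of J] 2 card by auto
    then obtain j where "j \<in> J" "j \<notin> J'" by blast
    moreover from this have "f j = 0" using disj sub by (intro supp) blast
    ultimately have "prod f J = 0" using fin by (auto simp: prod_zero_iff)
    with \<open>prod f I = 0\<close> show ?thesis by simp
  qed
  moreover have "f n = 0" if "n \<notin> I \<union> J" for n using that sub by (intro supp) blast
  ultimately show "f \<in> cell I J" unfolding cell_def using cellD(1,3)[OF f] by simp
qed

text \<open>A common point is supported on the common vertices. With at most one of these in each
  colour, the smaller cell is not subject to any product equation.\<close>

lemma cell_Int:
  assumes fin: "finite I" "finite J" "finite I'" "finite J'" and disj: "(I \<union> I') \<inter> (J \<union> J') = {}"
    and card: "card (I \<inter> I') \<le> 1" "card (J \<inter> J') \<le> 1"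
  shows "cell I J \<inter> cell I' J' = cell (I \<inter> I') (J \<inter> J')"
proof
  have "cell (I \<inter> I') (J \<inter> J') \<subseteq> cell I J" "cell (I \<inter> I') (J \<inter> J') \<subseteq> cell I' J'"
    using fin disj card by (intro cell_mono; blast)+
  then show "cell (I \<inter> I') (J \<inter> J') \<subseteq> cell I J \<inter> cell I' J'" by blast
  show "cell I J \<inter> cell I' J' \<subseteq> cell (I \<inter> I') (J \<inter> J')"
  proof
    fix f assume f: "f \<in> cell I J \<inter> cell I' J'"
    then have f1: "f \<in> cell I J" and f2: "f \<in> cell I' J'" by simp_all
    have supp: "f n = 0" if "n \<notin> (I \<inter> I') \<union> (J \<inter> J')" for n
    proof (cases "n \<in> I \<union> J")
      case True
      then have "n \<notin> I' \<union> J'" using that disj by blast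
      then show ?thesis by (rule cellD(2)[OF f2])
    qed (rule cellD(2)[OF f1])
    have "sum f ((I \<inter> I') \<union> (J \<inter> J')) = sum f (I \<union> J)"
      using fin supp by (intro sum.mono_neutral_left) auto
    then show "f \<in> cell (I \<inter> I') (J \<inter> J')"
      unfolding cell_def using supp cellD(1,3)[OF f1] card by simp
  qed
qed

lemma cell_support:
  assumes "finite I" "finite J" "n \<in> I \<union> J"
  shows "\<exists>f\<in>cell I J. f n \<noteq> 0"
proof
  \<comment> \<open>The barycentre: with equal weights, both diagonals of a square have the product
    \<open>c ^ 2\<close>.\<close>
  define c where "c = 1 / real (card (I \<union> J))"
  let ?f = "\<lambda>n. if n \<in> I \<union> J then c else 0"
  have pos: "card (I \<union> J) > 0" using assms by (auto simp: card_gt_0_iff)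
  then have "c \<noteq> 0" by (simp add: c_def)
  then show "?f n \<noteq> 0" using assms(3) by simp
  have "sum ?f (I \<union> J) = (\<Sum>n\<in>I \<union> J. c)" by (rule sum.cong) simp_all
  then have "sum ?f (I \<union> J) = 1" using pos by (simp add: c_def)
  moreover have "prod ?f I = c ^ card I" "prod ?f J = c ^ card J"
    by (simp_all add: prod.cong[of _ _ ?f "\<lambda>_. c"] flip: prod_constant)
  ultimately show "?f \<in> cell I J" by (simp add: cell_def c_def)
qed

lemma support_cell:
  assumes "finite I" "finite J"
  shows "{n. \<exists>f\<in>cell I J. f n \<noteq> 0} = I \<union> J"
  using cell_support[OF assms] cellD(2) by blast

text \<open>An inclusion of cells gives one of supports, and the colours separate \<open>I\<close>
  from \<open>J\<close>. Conversely, a square has two vertices of each colour, which already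
  exhausts any cell above it; smaller cells are covered by \<open>cell_mono\<close>.\<close>

lemma cell_subset_iff:
  assumes b: "built U B E Q" and c: "(I, J) \<in> cells U B E Q" "(I', J') \<in> cells U B E Q"
  shows "cell I J \<subseteq> cell I' J' \<longleftrightarrow> I \<subseteq> I' \<and> J \<subseteq> J'"
proof
  note sh = cells_shape[OF b c(1)] and sh' = cells_shape[OF b c(2)]
  have fin: "finite I" "finite J" "finite I'" "finite J'"
    using sh(3) sh'(3) unfolding cell_shape_def by simp_all
  have disj: "U \<inter> B = {}" using built_wf[OF b] by simp
  show "I \<subseteq> I' \<and> J \<subseteq> J'" if "cell I J \<subseteq> cell I' J'"
  proof -
    have "I \<union> J \<subseteq> I' \<union> J'"
      using support_cell[OF fin(1,2)] support_cell[OF fin(3,4)] that by blast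
    then show ?thesis using sh(1,2) sh'(1,2) disj by blast
  qed
  show "cell I J \<subseteq> cell I' J'" if sub: "I \<subseteq> I' \<and> J \<subseteq> J'"
  proof (cases "card I \<le> 1 \<and> card J \<le> 1")
    case True
    then show ?thesis using sub fin disj sh'(1,2) by (intro cell_mono) blast+
  next
    case False
    then have "card I = 2" "card J = 2" using sh(3) unfolding cell_shape_def by auto
    moreover have "card I' \<le> 2" "card J' \<le> 2" using sh'(3) unfolding cell_shape_def by auto
    ultimately have "I = I'" "J = J'" using sub fin card_seteq by metis+
    then show ?thesis by simp
  qed
qed

lemma cell_inj:
  assumes "built U B E Q"
  shows "inj_on (\<lambda>(I, J). cell I J) (cells U B E Q)"
proof (rule inj_onI, clarify)
  fix I J I' J'
  assume c: "(I, J) \<in> cells U B E Q" "(I', J') \<in> cells U B E Q" and eq: "cell I J = cell I' J'"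
  then show "I = I' \<and> J = J'"
    using cell_subset_iff[OF assms c] cell_subset_iff[OF assms c(2,1)] by blast
qed

lemma cell_Int_cases:
  assumes b: "built U B E Q" and c: "(I, J) \<in> cells U B E Q" "(I', J') \<in> cells U B E Q"
  shows "cell I J \<inter> cell I' J' = {} \<or>
    (\<exists>I'' J''. (I'', J'') \<in> cells U B E Q \<and> cell I J \<inter> cell I' J' = cell I'' J'')"
proof (cases "(I, J) = (I', J')")
  case False
  note sh = cells_shape[OF b c(1)] and sh' = cells_shape[OF b c(2)] and card = cells_Int[OF b c False]
  have fin: "finite I" "finite J" "finite I'" "finite J'"
    using sh(3) sh'(3) unfolding cell_shape_def by simp_all
  have eq: "cell I J \<inter> cell I' J' = cell (I \<inter> I') (J \<inter> J')"
    using fin card sh(1,2) sh'(1,2) built_wf[OF b] by (intro cell_Int) blast+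
  show ?thesis
  proof (cases "(I \<inter> I') \<union> (J \<inter> J') = {}")
    case True
    then have "cell (I \<inter> I') (J \<inter> J') = {}" by (simp add: cell_def)
    then show ?thesis using eq by simp
  next
    case ne: False
    have "(I \<inter> I', J \<inter> J') \<in> cells U B E Q"
      using cells_downward[OF b c(1) _ _ card ne] by blast
    then show ?thesis using eq by blast
  qed
qed (use c in blast)

subsection \<open>Charts of vertices, edges and squares\<close>

lemma in_cell_vertex:
  "f \<in> cell {i} {} \<longleftrightarrow> f = (\<lambda>n. if n = i then 1 else 0)"
  "f \<in> cell {} {i} \<longleftrightarrow> f = (\<lambda>n. if n = i then 1 else 0)"
proof -
  have "f \<in> cell {i} {} \<longleftrightarrow> (\<forall>n. 0 \<le> f n) \<and> (\<forall>n. n \<noteq> i \<longrightarrow> f n = 0) \<and> f i = 1"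
    "f \<in> cell {} {i} \<longleftrightarrow> (\<forall>n. 0 \<le> f n) \<and> (\<forall>n. n \<noteq> i \<longrightarrow> f n = 0) \<and> f i = 1"
    by (simp_all add: cell_def)
  moreover have "(\<forall>n. 0 \<le> f n) \<and> (\<forall>n. n \<noteq> i \<longrightarrow> f n = 0) \<and> f i = 1 \<longleftrightarrow> f = (\<lambda>n. if n = i then 1 else 0)"
  proof
    assume "(\<forall>n. 0 \<le> f n) \<and> (\<forall>n. n \<noteq> i \<longrightarrow> f n = 0) \<and> f i = 1"
    then show "f = (\<lambda>n. if n = i then 1 else 0)" by (intro ext) simp
  qed simp
  ultimately show "f \<in> cell {i} {} \<longleftrightarrow> f = (\<lambda>n. if n = i then 1 else 0)"
    "f \<in> cell {} {i} \<longleftrightarrow> f = (\<lambda>n. if n = i then 1 else 0)"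
    by simp_all
qed

lemma in_cell_edge:
  assumes "i \<noteq> j"
  shows "f \<in> cell {i} {j} \<longleftrightarrow> (\<forall>n. 0 \<le> f n) \<and> (\<forall>n. n \<notin> {i, j} \<longrightarrow> f n = 0) \<and> f i + f j = 1"
proof -
  have "{i} \<union> {j} = {i, j}" by auto
  then show ?thesis using assms unfolding cell_def by simp
qed

lemma in_cell_square:
  assumes "distinct [i, j, i', j']"
  shows "f \<in> cell {i, i'} {j, j'} \<longleftrightarrow> (\<forall>n. 0 \<le> f n) \<and> (\<forall>n. n \<notin> {i, j, i', j'} \<longrightarrow> f n = 0) \<and>
    f i + f j + f i' + f j' = 1 \<and> f i * f i' = f j * f j'"
proof -
  have "{i, i'} \<union> {j, j'} = {i, j, i', j'}" by auto
  then show ?thesis using assms unfolding cell_def by (simp add: add.assoc)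
qed

text \<open>Two adjacent weights that vanish make both products zero, so the product equation
  disappears and a segment remains. The other sides are obtained by relabelling.\<close>

lemma cell_square_side:
  assumes d: "distinct [i, j, i', j']"
  shows "{f \<in> cell {i, i'} {j, j'}. f j + f i' = 0} = cell {i} {j'}"
proof (intro equalityI subsetI)
  have ne: "i \<noteq> j'" using d by simp
  {
    fix f assume "f \<in> {f \<in> cell {i, i'} {j, j'}. f j + f i' = 0}"
    then have f: "f \<in> cell {i, i'} {j, j'}" and 0: "f j + f i' = 0" by simp_all
    note f = f[unfolded in_cell_square[OF d]]
    have "0 \<le> f j" "0 \<le> f i'" using f by simp_all
    then have z: "f j = 0" "f i' = 0" using 0 by linarith+
    have "f n = 0" if "n \<notin> {i, j'}" for n
      using that f z by (cases "n = j \<or> n = i'") auto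
    moreover have "f i + f j' = 1" using f z by simp
    ultimately show "f \<in> cell {i} {j'}" using f unfolding in_cell_edge[OF ne] by simp
  next
    fix f assume f: "f \<in> cell {i} {j'}"
    then have "f j = 0" "f i' = 0" using d unfolding in_cell_edge[OF ne] by simp_all
    then show "f \<in> {f \<in> cell {i, i'} {j, j'}. f j + f i' = 0}"
      using f d unfolding mem_Collect_eq in_cell_square[OF d] in_cell_edge[OF ne] by simp
  }
qed

lemma homeomorphism_image_eq:
  assumes "homeomorphism P C h g" "A \<subseteq> P"
  shows "h ` A = {y \<in> C. g y \<in> A}"
proof (intro equalityI subsetI)
  fix y assume "y \<in> h ` A"
  then show "y \<in> {y \<in> C. g y \<in> A}"
    using assms by (auto simp: homeomorphism_def)
next
  fix y assume "y \<in> {y \<in> C. g y \<in> A}"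
  then have "h (g y) = y" "g y \<in> A" using assms(1) by (auto simp: homeomorphism_def)
  then show "y \<in> h ` A" by (metis imageI)
qed

definition segment_map :: "nat \<Rightarrow> nat \<Rightarrow> real \<Rightarrow> nat \<Rightarrow> real" where
  "segment_map i j t = (\<lambda>n. if n = i then 1 - t else if n = j then t else 0)"

text \<open>The vertices run around the square, from the corner \<open>(0, 0)\<close> via
  \<open>(1, 0)\<close>, so that \<open>{i, i'}\<close> and \<open>{j, j'}\<close> are its
  diagonals.\<close>

definition square_map :: "nat \<Rightarrow> nat \<Rightarrow> nat \<Rightarrow> nat \<Rightarrow> real \<times> real \<Rightarrow> nat \<Rightarrow> real" where
  "square_map i j i' j' z = (\<lambda>n. if n = i then (1 - fst z) * (1 - snd z) else
     if n = j then fst z * (1 - snd z) else if n = i' then fst z * snd z else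
     if n = j' then (1 - fst z) * snd z else 0)"

lemma continuous_on_coordinate: "continuous_on S (\<lambda>f :: 'a \<Rightarrow> 'b::topological_space. f i)"
  by (rule continuous_on_subset[OF continuous_on_product_coordinates]) simp

lemma homeomorphism_segment:
  assumes "i \<noteq> j"
  shows "homeomorphism {0..1} (cell {i} {j}) (segment_map i j) (\<lambda>f. f j)"
proof (rule homeomorphismI)
  show "continuous_on {0..1} (segment_map i j)"
  proof (rule continuous_on_coordinatewise_then_product)
    show "continuous_on {0..1} (\<lambda>t. segment_map i j t n)" for n
      unfolding segment_map_def by (cases "n = i"; cases "n = j") (simp_all add: continuous_intros)
  qed
  show "segment_map i j ` {0..1} \<subseteq> cell {i} {j}"
    using assms by (auto simp: in_cell_edge segment_map_def)
  show "(\<lambda>f. f j) ` cell {i} {j} \<subseteq> {0..1}"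
  proof clarify
    fix f assume f: "f \<in> cell {i} {j}"
    then have "f i + f j = 1" "0 \<le> f i" "0 \<le> f j" using assms by (simp_all add: in_cell_edge)
    then show "f j \<in> {0..1}" by simp
  qed
  show "segment_map i j (f j) = f" if "f \<in> cell {i} {j}" for f
  proof
    show "segment_map i j (f j) n = f n" for n
      using that assms by (auto simp: segment_map_def in_cell_edge)
  qed
  show "segment_map i j t j = t" for t using assms by (simp add: segment_map_def)
qed (rule continuous_on_coordinate)

text \<open>The four weights form a 2 by 2 table, and the product equation says that its determinant
  vanishes. A table with total 1 and determinant 0 is the product of its marginals, and the inverse
  map reads off one entry of each marginal.\<close>

lemma homeomorphism_square:
  assumes d: "distinct [i, j, i', j']"
  shows "homeomorphism ({0..1} \<times> {0..1}) (cell {i, i'} {j, j'}) (square_map i j i' j')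
    (\<lambda>f. (f j + f i', f i' + f j'))"
proof (rule homeomorphismI)
  show "continuous_on ({0..1} \<times> {0..1}) (square_map i j i' j')"
  proof (rule continuous_on_coordinatewise_then_product)
    show "continuous_on ({0..1} \<times> {0..1}) (\<lambda>z. square_map i j i' j' z n)" for n
      unfolding square_map_def
      by (cases "n = i"; cases "n = j"; cases "n = i'"; cases "n = j'") (simp_all add: continuous_intros)
  qed
  show "continuous_on (cell {i, i'} {j, j'}) (\<lambda>f. (f j + f i', f i' + f j'))"
    by (intro continuous_on_Pair continuous_on_add continuous_on_coordinate)
  show "square_map i j i' j' ` ({0..1} \<times> {0..1}) \<subseteq> cell {i, i'} {j, j'}"
  proof (clarify)
    fix s t :: real assume "s \<in> {0..1}" "t \<in> {0..1}"
    then have "0 \<le> square_map i j i' j' (s, t) n" for n by (simp add: square_map_def)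
    moreover have "square_map i j i' j' (s, t) i = (1 - s) * (1 - t)" "square_map i j i' j' (s, t) j = s * (1 - t)"
      "square_map i j i' j' (s, t) i' = s * t" "square_map i j i' j' (s, t) j' = (1 - s) * t"
      using d by (simp_all add: square_map_def)
    moreover have "(1 - s) * (1 - t) + s * (1 - t) + s * t + (1 - s) * t = 1"
      by (simp add: algebra_simps)
    moreover have "square_map i j i' j' (s, t) n = 0" if "n \<notin> {i, j, i', j'}" for n
      using that by (simp add: square_map_def)
    ultimately show "square_map i j i' j' (s, t) \<in> cell {i, i'} {j, j'}"
      unfolding in_cell_square[OF d] by (simp add: mult_ac)
  qed
  show "(\<lambda>f. (f j + f i', f i' + f j')) ` cell {i, i'} {j, j'} \<subseteq> {0..1} \<times> {0..1}"
  proof clarify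
    fix f assume "f \<in> cell {i, i'} {j, j'}"
    then have "f i + f j + f i' + f j' = 1" "\<forall>n. 0 \<le> f n" unfolding in_cell_square[OF d] by simp_all
    moreover from this have "0 \<le> f i" "0 \<le> f j" "0 \<le> f i'" "0 \<le> f j'" by simp_all
    ultimately show "f j + f i' \<in> {0..1} \<and> f i' + f j' \<in> {0..1}"
      unfolding atLeastAtMost_iff by (intro conjI) linarith+
  qed
  show "square_map i j i' j' (f j + f i', f i' + f j') = f" if f: "f \<in> cell {i, i'} {j, j'}" for f
  proof -
    \<comment> \<open>Once \<open>f i\<close> is eliminated, each of the four coordinates is a
      rearrangement of the product equation.\<close>
    have sum: "f i = 1 - f j - f i' - f j'" and prod: "f i * f i' = f j * f j'"
      using f unfolding in_cell_square[OF d] by linarith+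
    have p: "(1 - f j - f i' - f j') * f i' = f j * f j'" using prod sum by simp
    have "(1 - (f j + f i')) * (1 - (f i' + f j')) = f i" "(f j + f i') * (1 - (f i' + f j')) = f j"
      "(f j + f i') * (f i' + f j') = f i'" "(1 - (f j + f i')) * (f i' + f j') = f j'"
      unfolding sum using p by (simp_all add: algebra_simps)
    note coords = this
    have "f n = 0" if "n \<notin> {i, j, i', j'}" for n
      using that f unfolding in_cell_square[OF d] by simp
    then show ?thesis
      unfolding square_map_def fst_conv snd_conv coords by (intro ext) simp
  qed
  show "(\<lambda>f. (f j + f i', f i' + f j')) (square_map i j i' j' z) = z" for z
    using d by (cases z) (simp add: square_map_def algebra_simps)
qed

section \<open>The unit cube and its faces in dimensions 0, 1 and 2\<close>

lemma homeomorphism_unit_cube_0: "homeomorphism (unit_cube 0) {a} (\<lambda>_. a) (\<lambda>_ _. undefined)"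
  by (rule homeomorphismI) (simp_all add: unit_cube_def PiE_empty_domain)

lemma homeomorphism_unit_cube_1:
  "homeomorphism (unit_cube 1) {0..1} (\<lambda>x. x 0) (\<lambda>t. \<lambda>n\<in>{..<1}. t)"
proof (rule homeomorphismI)
  show "continuous_on {0..1} (\<lambda>t. \<lambda>n\<in>{..<1::nat}. t :: real)"
  proof (rule continuous_on_coordinatewise_then_product)
    show "continuous_on {0..1} (\<lambda>t. (\<lambda>n\<in>{..<1::nat}. t :: real) n)" for n by (cases "n = 0") simp_all
  qed
  show "(\<lambda>n\<in>{..<1}. x 0) = x" if "x \<in> unit_cube 1" for x
    using that by (auto simp: unit_cube_def PiE_iff extensional_def fun_eq_iff)
  show "(\<lambda>x. x 0) ` unit_cube 1 \<subseteq> {0..1}"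
  proof (rule image_subsetI)
    fix x :: "nat \<Rightarrow> real" assume "x \<in> unit_cube 1"
    then show "x 0 \<in> {0..1}" unfolding unit_cube_def by (rule PiE_mem) simp
  qed
  show "(\<lambda>t. \<lambda>n\<in>{..<1}. t) ` {0..1} \<subseteq> unit_cube 1"
    unfolding unit_cube_def by (intro image_subsetI restrict_PiE_iff[THEN iffD2]) simp
qed (simp_all add: continuous_on_coordinate)

lemma homeomorphism_unit_cube_2:
  "homeomorphism (unit_cube 2) ({0..1} \<times> {0..1}) (\<lambda>x. (x 0, x 1))
    (\<lambda>z. \<lambda>n\<in>{..<2}. if n = 0 then fst z else snd z)"
proof (rule homeomorphismI)
  have less2: "n < 2 \<longleftrightarrow> n = 0 \<or> n = 1" for n :: nat by auto
  show "continuous_on (unit_cube 2) (\<lambda>x. (x 0, x 1))"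
    by (intro continuous_on_Pair continuous_on_coordinate)
  show "continuous_on ({0..1} \<times> {0..1}) (\<lambda>z. \<lambda>n\<in>{..<2::nat}. if n = 0 then fst z else snd z :: real)"
  proof (rule continuous_on_coordinatewise_then_product)
    show "continuous_on ({0..1} \<times> {0..1})
        (\<lambda>z. (\<lambda>n\<in>{..<2::nat}. if n = 0 then fst z else snd z :: real) n)" for n
      by (cases "n < 2"; cases "n = 0") (simp_all add: continuous_on_fst continuous_on_snd)
  qed
  show "(\<lambda>n\<in>{..<2}. if n = 0 then fst (x 0, x 1) else snd (x 0, x 1)) = x" if "x \<in> unit_cube 2" for x
    using that by (auto simp: unit_cube_def PiE_iff extensional_def fun_eq_iff less2)
  show "(\<lambda>x. (x 0, x 1)) ` unit_cube 2 \<subseteq> {0..1} \<times> {0..1}"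
  proof (rule image_subsetI)
    fix x :: "nat \<Rightarrow> real" assume "x \<in> unit_cube 2"
    then show "(x 0, x 1) \<in> {0..1} \<times> {0..1}"
      unfolding unit_cube_def using PiE_mem[of x "{..<2}" "\<lambda>_. {0..1}"] by simp
  qed
  show "(\<lambda>z. \<lambda>n\<in>{..<2}. if n = 0 then fst z else snd z) ` ({0..1} \<times> {0..1}) \<subseteq> unit_cube 2"
    unfolding unit_cube_def by (intro image_subsetI restrict_PiE_iff[THEN iffD2]) (simp add: mem_Times_iff)
qed simp

lemma cube_faces_0: "cube_faces 0 h = {h ` unit_cube 0}"
  by (simp add: cube_faces_def unit_cube_faces_def unit_cube_def)

lemma cube_faces_1: "cube_faces 1 (\<lambda>x. h (x 0)) = (\<lambda>T. h ` T) ` interval_faces"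
proof -
  have "(\<lambda>x. x 0) ` Pi\<^sub>E {..<1} I = I 0" for I :: "nat \<Rightarrow> real set"
  proof
    show "I 0 \<subseteq> (\<lambda>x. x 0) ` Pi\<^sub>E {..<1} I"
    proof
      fix t assume "t \<in> I 0"
      then show "t \<in> (\<lambda>x. x 0) ` Pi\<^sub>E {..<1} I"
        by (intro image_eqI[of _ _ "\<lambda>n\<in>{..<1}. t"]) (simp_all add: restrict_PiE_iff)
    qed
    show "(\<lambda>x. x 0) ` Pi\<^sub>E {..<1} I \<subseteq> I 0"
    proof (rule image_subsetI)
      fix x assume "x \<in> Pi\<^sub>E {..<1} I"
      then show "x 0 \<in> I 0" by (rule PiE_mem) simp
    qed
  qed
  then have im: "(\<lambda>x. h (x 0)) ` Pi\<^sub>E {..<1} I = h ` I 0" for I :: "nat \<Rightarrow> real set"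
    by (metis image_image)
  show ?thesis
  proof (intro equalityI subsetI)
    fix X assume "X \<in> cube_faces 1 (\<lambda>x. h (x 0))"
    then obtain I :: "nat \<Rightarrow> real set" where "\<forall>i<1. I i \<in> interval_faces" "X = (\<lambda>x. h (x 0)) ` Pi\<^sub>E {..<1} I"
      by (rule cube_facesE)
    then show "X \<in> (\<lambda>T. h ` T) ` interval_faces" unfolding im by simp
  next
    fix X assume "X \<in> (\<lambda>T. h ` T) ` interval_faces"
    then obtain T where T: "T \<in> interval_faces" "X = h ` T" by blast
    have X: "X = (\<lambda>x. h (x 0)) ` Pi\<^sub>E {..<1::nat} (\<lambda>_. T)" unfolding im T(2) ..
    show "X \<in> cube_faces 1 (\<lambda>x. h (x 0))" unfolding X using T(1) by (intro cube_facesI)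
  qed
qed

lemma cube_faces_2:
  "cube_faces 2 (\<lambda>x. h (x 0, x 1)) = (\<lambda>(S, T). h ` (S \<times> T)) ` (interval_faces \<times> interval_faces)"
proof -
  have less2: "n < 2 \<longleftrightarrow> n = 0 \<or> n = 1" for n :: nat by auto
  have "(\<lambda>x. (x 0, x 1)) ` Pi\<^sub>E {..<2} I = I 0 \<times> I 1" for I :: "nat \<Rightarrow> real set"
  proof
    show "I 0 \<times> I 1 \<subseteq> (\<lambda>x. (x 0, x 1)) ` Pi\<^sub>E {..<2} I"
    proof clarify
      fix s t assume "s \<in> I 0" "t \<in> I 1"
      then show "(s, t) \<in> (\<lambda>x. (x 0, x 1)) ` Pi\<^sub>E {..<2} I"
        by (intro image_eqI[of _ _ "\<lambda>n\<in>{..<2}. if n = 0 then s else t"])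
          (simp_all add: restrict_PiE_iff less2)
    qed
    show "(\<lambda>x. (x 0, x 1)) ` Pi\<^sub>E {..<2} I \<subseteq> I 0 \<times> I 1"
    proof (rule image_subsetI)
      fix x assume "x \<in> Pi\<^sub>E {..<2} I"
      then show "(x 0, x 1) \<in> I 0 \<times> I 1" using PiE_mem[of x "{..<2}" I] by simp
    qed
  qed
  then have im: "(\<lambda>x. h (x 0, x 1)) ` Pi\<^sub>E {..<2} I = h ` (I 0 \<times> I 1)" for I :: "nat \<Rightarrow> real set"
    by (metis image_image)
  show ?thesis
  proof (intro equalityI subsetI)
    fix X assume "X \<in> cube_faces 2 (\<lambda>x. h (x 0, x 1))"
    then obtain I :: "nat \<Rightarrow> real set" where "\<forall>i<2. I i \<in> interval_faces" "X = (\<lambda>x. h (x 0, x 1)) ` Pi\<^sub>E {..<2} I"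
      by (rule cube_facesE)
    then show "X \<in> (\<lambda>(S, T). h ` (S \<times> T)) ` (interval_faces \<times> interval_faces)"
      unfolding im by (intro image_eqI[of _ _ "(I 0, I 1)"]) simp_all
  next
    fix X assume "X \<in> (\<lambda>(S, T). h ` (S \<times> T)) ` (interval_faces \<times> interval_faces)"
    then obtain S T where ST: "S \<in> interval_faces" "T \<in> interval_faces" and X: "X = h ` (S \<times> T)" by auto
    define I where "I = (\<lambda>n :: nat. if n = 0 then S else T)"
    have X': "X = (\<lambda>x. h (x 0, x 1)) ` Pi\<^sub>E {..<2} I" unfolding im X by (simp add: I_def)
    have "\<forall>i<2. I i \<in> interval_faces" using ST by (simp add: I_def)
    then show "X \<in> cube_faces 2 (\<lambda>x. h (x 0, x 1))"
      unfolding X' by (intro cube_facesI) simp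
  qed
qed

section \<open>The complex of all cells and the faces of each of its members\<close>

definition cell_complex :: "nat set \<Rightarrow> nat set \<Rightarrow> (nat \<times> nat) set \<Rightarrow> (nat set \<times> nat set) set \<Rightarrow> (nat \<Rightarrow> real) set set" where
  "cell_complex U B E Q = (\<lambda>(I, J). cell I J) ` cells U B E Q"

text \<open>A vertex, edge or square has 1, 2 or 4 vertices in its support.\<close>

definition cell_dim :: "(nat \<Rightarrow> real) set \<Rightarrow> nat" where
  "cell_dim C = card {n. \<exists>f\<in>C. f n \<noteq> 0} div 2"

lemma cell_complexI: "(I, J) \<in> cells U B E Q \<Longrightarrow> cell I J \<in> cell_complex U B E Q"
  unfolding cell_complex_def by blast

lemma cell_complexE:
  assumes "C \<in> cell_complex U B E Q"
  obtains I J where "(I, J) \<in> cells U B E Q" "C = cell I J"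
  using assms unfolding cell_complex_def by auto

lemma cells_disjoint:
  assumes b: "built U B E Q" and "(I, J) \<in> cells U B E Q"
  shows "finite I" "finite J" "I \<inter> J = {}"
  using cells_shape[OF assms] built_wf[OF b] unfolding cell_shape_def by blast+

lemma cell_dim_cell:
  assumes b: "built U B E Q" and "(I, J) \<in> cells U B E Q"
  shows "cell_dim (cell I J) = (card I + card J) div 2"
  using cells_disjoint[OF assms] by (simp add: cell_dim_def support_cell card_Un_disjoint)

lemma square_distinct:
  assumes b: "built U B E Q" and "(I, J) \<in> Q"
  obtains i j i' j' where "I = {i, i'}" "J = {j, j'}" "distinct [i, j, i', j']"
proof -
  have card: "card I = 2" "card J = 2" using built_square_edges[OF assms] by simp_all
  have "(I, J) \<in> cells U B E Q" using assms(2) by (simp add: cells_def)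
  then have disj: "I \<inter> J = {}" using cells_disjoint[OF b] by blast
  obtain i i' where I: "I = {i, i'}" "i \<noteq> i'" using card(1) by (auto simp: card_2_iff)
  obtain j j' where J: "J = {j, j'}" "j \<noteq> j'" using card(2) by (auto simp: card_2_iff)
  show thesis using I J disj by (intro that[of i i' j j']) auto
qed

text \<open>A square contains no other square, so every proper face has at most one vertex of each
  colour. By \<open>cells_downward\<close> all such faces do belong to the complex, which is why the
  right-hand side does not mention \<open>E\<close>.\<close>

lemma faces_below:
  assumes b: "built U B E Q" and c: "(I, J) \<in> cells U B E Q"
  shows "{D \<in> cell_complex U B E Q. D \<subseteq> cell I J} =
    insert (cell I J) {cell I' J' | I' J'. I' \<subseteq> I \<and> J' \<subseteq> J \<and> card I' \<le> 1 \<and> card J' \<le> 1 \<and> I' \<union> J' \<noteq> {}}"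
proof (intro equalityI subsetI)
  fix D assume "D \<in> {D \<in> cell_complex U B E Q. D \<subseteq> cell I J}"
  then obtain I' J' where c': "(I', J') \<in> cells U B E Q" and D: "D = cell I' J'" "cell I' J' \<subseteq> cell I J"
    by (auto elim: cell_complexE)
  have sub: "I' \<subseteq> I" "J' \<subseteq> J" using cell_subset_iff[OF b c' c] D(2) by simp_all
  have sh: "cell_shape I J" "cell_shape I' J'" using cells_shape(3)[OF b c] cells_shape(3)[OF b c'] .
  show "D \<in> insert (cell I J) {cell I' J' | I' J'. I' \<subseteq> I \<and> J' \<subseteq> J \<and> card I' \<le> 1 \<and> card J' \<le> 1 \<and> I' \<union> J' \<noteq> {}}"
  proof (cases "card I' \<le> 1 \<and> card J' \<le> 1")
    case True
    then show ?thesis using sub D sh(2) unfolding cell_shape_def by blast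
  next
    case False
    then have "card I' = 2" "card J' = 2" using sh(2) unfolding cell_shape_def by auto
    moreover have "card I \<le> 2" "card J \<le> 2" "finite I" "finite J" using sh(1) unfolding cell_shape_def by auto
    ultimately have "I' = I" "J' = J" using sub card_seteq by metis+
    then show ?thesis using D(1) by simp
  qed
next
  fix D
  assume "D \<in> insert (cell I J) {cell I' J' | I' J'. I' \<subseteq> I \<and> J' \<subseteq> J \<and> card I' \<le> 1 \<and> card J' \<le> 1 \<and> I' \<union> J' \<noteq> {}}"
  then consider "D = cell I J"
    | I' J' where "D = cell I' J'" "I' \<subseteq> I" "J' \<subseteq> J" "card I' \<le> 1" "card J' \<le> 1" "I' \<union> J' \<noteq> {}" by blast
  then show "D \<in> {D \<in> cell_complex U B E Q. D \<subseteq> cell I J}"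
  proof cases
    case 1
    then show ?thesis using cell_complexI[OF c] by simp
  next
    case 2
    then have c': "(I', J') \<in> cells U B E Q" by (intro cells_downward[OF b c])
    have "cell I' J' \<subseteq> cell I J" using cell_subset_iff[OF b c' c] 2(2,3) by simp
    then show ?thesis using cell_complexI[OF c'] 2(1) by simp
  qed
qed

lemma small_subsets:
  "{I'. I' \<subseteq> {} \<and> card I' \<le> 1} = {{}}"
  "{I'. I' \<subseteq> {a} \<and> card I' \<le> 1} = {{}, {a}}"
  "{I'. I' \<subseteq> {a, a'} \<and> card I' \<le> 1} = {{}, {a}, {a'}}"
proof -
  show "{I'. I' \<subseteq> {} \<and> card I' \<le> 1} = {{}}" by auto
  show "{I'. I' \<subseteq> {a} \<and> card I' \<le> 1} = {{}, {a}}" by (auto simp: subset_singleton_iff)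
  show "{I'. I' \<subseteq> {a, a'} \<and> card I' \<le> 1} = {{}, {a}, {a'}}"
  proof (intro equalityI subsetI)
    fix I' assume "I' \<in> {I'. I' \<subseteq> {a, a'} \<and> card I' \<le> 1}"
    then have sub: "I' \<subseteq> {a, a'}" and card: "card I' \<le> 1" by simp_all
    have "finite I'" using sub by (rule finite_subset) simp
    then have "I' = {} \<or> (\<exists>i. I' = {i})" using card by (rule card_le_1_cases)
    then show "I' \<in> {{}, {a}, {a'}}" using sub by blast
  qed auto
qed

text \<open>Written as an image of a finite product, the list of faces can be enumerated by
  \<open>small_subsets\<close> and compared with the faces of a chart.\<close>

lemma faces_below_image:
  assumes b: "built U B E Q" and c: "(I, J) \<in> cells U B E Q"
  shows "{D \<in> cell_complex U B E Q. D \<subseteq> cell I J} = insert (cell I J)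
    ((\<lambda>(I', J'). cell I' J') `
      ({I'. I' \<subseteq> I \<and> card I' \<le> 1} \<times> {J'. J' \<subseteq> J \<and> card J' \<le> 1} - {({}, {})}))"
proof -
  have "{cell I' J' | I' J'. I' \<subseteq> I \<and> J' \<subseteq> J \<and> card I' \<le> 1 \<and> card J' \<le> 1 \<and> I' \<union> J' \<noteq> {}} =
      (\<lambda>(I', J'). cell I' J') `
        ({I'. I' \<subseteq> I \<and> card I' \<le> 1} \<times> {J'. J' \<subseteq> J \<and> card J' \<le> 1} - {({}, {})})"
    (is "?L = ?f ` ?R")
  proof (intro equalityI subsetI)
    fix D assume "D \<in> ?L"
    then obtain I' J' where D: "D = cell I' J'" and mem: "(I', J') \<in> ?R" by blast
    show "D \<in> ?f ` ?R" unfolding D using imageI[OF mem, of ?f] by simp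
  next
    fix D assume "D \<in> ?f ` ?R"
    then obtain z where "z \<in> ?R" "D = ?f z" by (rule imageE)
    then show "D \<in> ?L" by (cases z) auto
  qed
  then show ?thesis unfolding faces_below[OF assms] by simp
qed

lemma chart_vertex:
  fixes a :: "nat \<Rightarrow> real"
  shows "\<exists>h g. homeomorphism (unit_cube 0) {a} h g \<and> cube_faces 0 h = {{a}}"
proof (intro exI conjI)
  show "homeomorphism (unit_cube 0) {a} (\<lambda>_. a) (\<lambda>_ _. undefined)" by (rule homeomorphism_unit_cube_0)
  show "cube_faces 0 (\<lambda>_. a) = {{a}}" using unit_cube_nonempty[of 0] by (auto simp: cube_faces_0)
qed

lemma segment_ends:
  assumes "i \<noteq> j"
  shows "segment_map i j ` {0} = cell {i} {}" "segment_map i j ` {1} = cell {} {j}"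
    "segment_map i j ` {0..1} = cell {i} {j}"
proof -
  have "segment_map i j 0 = (\<lambda>n. if n = i then 1 else 0)" "segment_map i j 1 = (\<lambda>n. if n = j then 1 else 0)"
    using assms by (auto simp: segment_map_def fun_eq_iff)
  then show "segment_map i j ` {0} = cell {i} {}" "segment_map i j ` {1} = cell {} {j}"
    using in_cell_vertex by (simp_all add: set_eq_iff)
  show "segment_map i j ` {0..1} = cell {i} {j}"
    using homeomorphism_segment[OF assms] by (rule homeomorphism_image1)
qed

lemma chart_edge:
  assumes "i \<noteq> j"
  shows "\<exists>h g. homeomorphism (unit_cube 1) (cell {i} {j}) h g \<and>
    cube_faces 1 h = {cell {i} {}, cell {} {j}, cell {i} {j}}"
proof (intro exI conjI)
  show "homeomorphism (unit_cube 1) (cell {i} {j}) (segment_map i j \<circ> (\<lambda>x. x 0)) ((\<lambda>t. \<lambda>n\<in>{..<1}. t) \<circ> (\<lambda>f. f j))"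
    using homeomorphism_unit_cube_1 homeomorphism_segment[OF assms] by (rule homeomorphism_compose)
  show "cube_faces 1 (segment_map i j \<circ> (\<lambda>x. x 0)) = {cell {i} {}, cell {} {j}, cell {i} {j}}"
    unfolding comp_def cube_faces_1 interval_faces_def using segment_ends[OF assms] by simp
qed

lemma square_sides:
  assumes d: "distinct [i, j, i', j']"
  defines "h \<equiv> square_map i j i' j'"
  shows "h ` ({0} \<times> {0..1}) = cell {i} {j'}" "h ` ({1} \<times> {0..1}) = cell {i'} {j}"
    "h ` ({0..1} \<times> {0}) = cell {i} {j}" "h ` ({0..1} \<times> {1}) = cell {i'} {j'}"
    "h ` ({0..1} \<times> {0..1}) = cell {i, i'} {j, j'}"
proof -
  let ?C = "cell {i, i'} {j, j'}"
  note hom = homeomorphism_square[OF d]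
  have im: "h ` (S \<times> T) = {f \<in> ?C. f j + f i' \<in> S \<and> f i' + f j' \<in> T}" if "S \<subseteq> {0..1}" "T \<subseteq> {0..1}" for S T
    using homeomorphism_image_eq[OF hom, of "S \<times> T"] that unfolding h_def by auto
  have full: "f j + f i' \<in> {0..1} \<and> f i' + f j' \<in> {0..1}" if "f \<in> ?C" for f
    using homeomorphism_image2[OF hom] that by blast
  have sum: "f i + f j + f i' + f j' = 1" if "f \<in> ?C" for f
    using that unfolding in_cell_square[OF d] by simp
  have perm: "{i', i} = {i, i'}" "{j', j} = {j, j'}" by auto
  \<comment> \<open>Three symmetries of the square that preserve its pair of diagonals; they carry
    the side in \<open>cell_square_side\<close> to the three others.\<close>
  have d': "distinct [i', j', i, j]" "distinct [i, j', i', j]" "distinct [i', j, i, j']" using d by auto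
  note side = cell_square_side[OF d] cell_square_side[OF d'(1)] cell_square_side[OF d'(2)] cell_square_side[OF d'(3)]
  note side = side[unfolded perm]
  have "h ` ({0} \<times> {0..1}) = {f \<in> ?C. f j + f i' = 0}" using full by (subst im) auto
  then show "h ` ({0} \<times> {0..1}) = cell {i} {j'}" using side(1) by simp
  have "h ` ({1} \<times> {0..1}) = {f \<in> ?C. f j' + f i = 0}"
    using full sum by (subst im) (force simp: algebra_simps)+
  then show "h ` ({1} \<times> {0..1}) = cell {i'} {j}" using side(2) by simp
  have "h ` ({0..1} \<times> {0}) = {f \<in> ?C. f j' + f i' = 0}" using full by (subst im) (auto simp: add.commute)
  then show "h ` ({0..1} \<times> {0}) = cell {i} {j}" using side(3) by simp
  have "h ` ({0..1} \<times> {1}) = {f \<in> ?C. f j + f i = 0}"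
    using full sum by (subst im) (force simp: algebra_simps)+
  then show "h ` ({0..1} \<times> {1}) = cell {i'} {j'}" using side(4) by simp
  show "h ` ({0..1} \<times> {0..1}) = ?C" unfolding h_def using hom by (rule homeomorphism_image1)
qed

lemma square_corners:
  assumes d: "distinct [i, j, i', j']"
  shows "square_map i j i' j' ` ({0} \<times> {0}) = cell {i} {}" "square_map i j i' j' ` ({1} \<times> {0}) = cell {} {j}"
    "square_map i j i' j' ` ({1} \<times> {1}) = cell {i'} {}" "square_map i j i' j' ` ({0} \<times> {1}) = cell {} {j'}"
proof -
  have ne: "i \<noteq> j" "i \<noteq> i'" "i \<noteq> j'" "j \<noteq> i'" "j \<noteq> j'" "i' \<noteq> j'" using d by simp_all
  have "square_map i j i' j' (0, 0) n = (if n = i then 1 else 0)"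
    "square_map i j i' j' (1, 0) n = (if n = j then 1 else 0)"
    "square_map i j i' j' (1, 1) n = (if n = i' then 1 else 0)"
    "square_map i j i' j' (0, 1) n = (if n = j' then 1 else 0)" for n
    by (simp_all add: square_map_def ne ne[symmetric])
  then have "square_map i j i' j' (0, 0) = (\<lambda>n. if n = i then 1 else 0)"
    "square_map i j i' j' (1, 0) = (\<lambda>n. if n = j then 1 else 0)"
    "square_map i j i' j' (1, 1) = (\<lambda>n. if n = i' then 1 else 0)"
    "square_map i j i' j' (0, 1) = (\<lambda>n. if n = j' then 1 else 0)"
    by (simp_all only: fun_eq_iff simp_thms)
  then show "square_map i j i' j' ` ({0} \<times> {0}) = cell {i} {}" "square_map i j i' j' ` ({1} \<times> {0}) = cell {} {j}"
    "square_map i j i' j' ` ({1} \<times> {1}) = cell {i'} {}" "square_map i j i' j' ` ({0} \<times> {1}) = cell {} {j'}"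
    using in_cell_vertex by (simp_all add: set_eq_iff)
qed

lemma chart_square:
  assumes d: "distinct [i, j, i', j']"
  shows "\<exists>h g. homeomorphism (unit_cube 2) (cell {i, i'} {j, j'}) h g \<and>
    cube_faces 2 h = {cell {i} {}, cell {i'} {}, cell {} {j}, cell {} {j'}, cell {i} {j}, cell {i} {j'},
      cell {i'} {j}, cell {i'} {j'}, cell {i, i'} {j, j'}}"
proof (intro exI conjI)
  let ?p = "\<lambda>x :: nat \<Rightarrow> real. (x 0, x 1)"
  show "homeomorphism (unit_cube 2) (cell {i, i'} {j, j'}) (square_map i j i' j' \<circ> ?p)
     ((\<lambda>z. \<lambda>n\<in>{..<2}. if n = 0 then fst z else snd z) \<circ> (\<lambda>f. (f j + f i', f i' + f j')))"
    using homeomorphism_unit_cube_2 homeomorphism_square[OF d] by (rule homeomorphism_compose)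
  have prod: "interval_faces \<times> interval_faces = {({0}, {0}), ({0}, {1}), ({0}, {0..1}), ({1}, {0}), ({1}, {1}),
      ({1}, {0..1}), ({0..1}, {0}), ({0..1}, {1}), ({0..1}, {0..1})}"
    unfolding interval_faces_def by blast
  have "cube_faces 2 (square_map i j i' j' \<circ> ?p) =
     {cell {i} {}, cell {} {j'}, cell {i} {j'}, cell {} {j}, cell {i'} {}, cell {i'} {j},
      cell {i} {j}, cell {i'} {j'}, cell {i, i'} {j, j'}}"
    unfolding comp_def cube_faces_2 prod image_insert image_empty case_prod_conv square_sides[OF d] square_corners[OF d]
    by (rule refl)
  also have "\<dots> = {cell {i} {}, cell {i'} {}, cell {} {j}, cell {} {j'}, cell {i} {j}, cell {i} {j'},
      cell {i'} {j}, cell {i'} {j'}, cell {i, i'} {j, j'}}"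
    by (simp only: insert_commute)
  finally show "cube_faces 2 (square_map i j i' j' \<circ> ?p) = {cell {i} {}, cell {i'} {}, cell {} {j}, cell {} {j'},
      cell {i} {j}, cell {i} {j'}, cell {i'} {j}, cell {i'} {j'}, cell {i, i'} {j, j'}}" .
qed

lemma cubical_cell_complex:
  assumes b: "built U B E Q"
  shows "cubical (cell_complex U B E Q) cell_dim"
  unfolding cubical_def
proof (intro conjI ballI)
  have fin: "finite U" "finite B" "finite E" "finite Q" using built_finite[OF b] by simp_all
  have "cells U B E Q = (\<lambda>i. ({i}, {})) ` U \<union> (\<lambda>j. ({}, {j})) ` B \<union> (\<lambda>(i, j). ({i}, {j})) ` E \<union> Q"
    unfolding cells_def by auto
  then show "finite (cell_complex U B E Q)" unfolding cell_complex_def using fin by simp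
  show "C \<inter> D = {} \<or> C \<inter> D \<in> cell_complex U B E Q"
    if C: "C \<in> cell_complex U B E Q" and D: "D \<in> cell_complex U B E Q" for C D
  proof -
    obtain I J where c: "(I, J) \<in> cells U B E Q" "C = cell I J" using C by (rule cell_complexE)
    obtain I' J' where c': "(I', J') \<in> cells U B E Q" "D = cell I' J'" using D by (rule cell_complexE)
    show ?thesis using cell_Int_cases[OF b c(1) c'(1)] cell_complexI unfolding c(2) c'(2) by metis
  qed
  show "\<exists>h g. homeomorphism (unit_cube (cell_dim C)) C h g \<and>
      cube_faces (cell_dim C) h = {D \<in> cell_complex U B E Q. D \<subseteq> C}"
    if C: "C \<in> cell_complex U B E Q" for C
  proof -
    obtain I J where c: "(I, J) \<in> cells U B E Q" and CIJ: "C = cell I J" using C by (rule cell_complexE)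
    note dim = cell_dim_cell[OF b c] and below = faces_below[OF b c] and below_im = faces_below_image[OF b c]
    show ?thesis
      using c
    proof (cases rule: cells_cases)
      case (1 i)
      have C: "cell {i} {} = {\<lambda>n. if n = i then 1 else 0}" using in_cell_vertex by blast
      have "{D \<in> cell_complex U B E Q. D \<subseteq> cell I J} = {cell {i} {}}"
        unfolding below unfolding 1 by (auto simp: subset_singleton_iff)
      then show ?thesis using chart_vertex dim unfolding CIJ 1 C by simp
    next
      case (2 j)
      have C: "cell {} {j} = {\<lambda>n. if n = j then 1 else 0}" using in_cell_vertex by blast
      have "{D \<in> cell_complex U B E Q. D \<subseteq> cell I J} = {cell {} {j}}"
        unfolding below unfolding 2 by (auto simp: subset_singleton_iff)
      then show ?thesis using chart_vertex dim unfolding CIJ 2 C by simp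
    next
      case (3 i j)
      have ne: "i \<noteq> j" using cells_disjoint(3)[OF b c] 3 by simp
      have "{{}, {i}} \<times> {{}, {j}} - {({}, {})} = {({i}, {}), ({}, {j}), ({i}, {j})}" by auto
      then have "{D \<in> cell_complex U B E Q. D \<subseteq> cell I J} = {cell {i} {}, cell {} {j}, cell {i} {j}}"
        unfolding below_im unfolding 3 small_subsets by auto
      moreover have "cell_dim (cell I J) = 1" using dim 3 by simp
      ultimately show ?thesis using chart_edge[OF ne] unfolding CIJ 3 by simp
    next
      case 4
      obtain i j i' j' where sq: "I = {i, i'}" "J = {j, j'}" and d: "distinct [i, j, i', j']"
        using b 4 by (rule square_distinct)
      have "{{}, {i}, {i'}} \<times> {{}, {j}, {j'}} - {({}, {})} =
          {({i}, {}), ({i'}, {}), ({}, {j}), ({}, {j'}), ({i}, {j}), ({i}, {j'}), ({i'}, {j}), ({i'}, {j'})}"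
        by auto
      then have "{D \<in> cell_complex U B E Q. D \<subseteq> cell I J} = insert (cell {i, i'} {j, j'})
         {cell {i} {}, cell {i'} {}, cell {} {j}, cell {} {j'}, cell {i} {j}, cell {i} {j'}, cell {i'} {j}, cell {i'} {j'}}"
        unfolding below_im unfolding sq small_subsets(3) by simp
      also have "\<dots> = {cell {i} {}, cell {i'} {}, cell {} {j}, cell {} {j'}, cell {i} {j}, cell {i} {j'},
          cell {i'} {j}, cell {i'} {j'}, cell {i, i'} {j, j'}}"
        by (simp only: insert_commute)
      finally have "{D \<in> cell_complex U B E Q. D \<subseteq> cell I J} = \<dots>" .
      moreover have "cell_dim (cell I J) = 2" using dim sq d by simp
      ultimately show ?thesis using chart_square[OF d] unfolding CIJ sq by simp
    qed
  qed
qed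

subsection \<open>Contractibility and counting\<close>

lemma compact_cell:
  assumes b: "built U B E Q" and c: "(I, J) \<in> cells U B E Q"
  shows "compact (cell I J)"
  using c
proof (cases rule: cells_cases)
  case (1 i)
  then have "cell I J = {\<lambda>n. if n = i then 1 else 0}" using in_cell_vertex(1)[of _ i] by blast
  then show ?thesis by simp
next
  case (2 j)
  then have "cell I J = {\<lambda>n. if n = j then 1 else 0}" using in_cell_vertex(2)[of _ j] by blast
  then show ?thesis by simp
next
  case (3 i j)
  then have "i \<noteq> j" using cells_disjoint(3)[OF b c] by simp
  from homeomorphism_segment[OF this] have "continuous_on {0..1} (segment_map i j)"
    by (auto simp: homeomorphism_def)
  then have "compact (segment_map i j ` {0..1})" by (intro compact_continuous_image) simp_all
  then show ?thesis using 3 segment_ends(3)[OF \<open>i \<noteq> j\<close>] by simp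
next
  case 4
  obtain i j i' j' where sq: "I = {i, i'}" "J = {j, j'}" and d: "distinct [i, j, i', j']"
    using b 4 by (rule square_distinct)
  have "continuous_on ({0..1} \<times> {0..1}) (square_map i j i' j')"
    using homeomorphism_square[OF d] unfolding homeomorphism_def by blast
  then have "compact (square_map i j i' j' ` ({0..1} \<times> {0..1}))"
    by (intro compact_continuous_image compact_Times) simp_all
  then show ?thesis using sq square_sides(5)[OF d] by simp
qed

lemma closed_Union_cell_complex:
  assumes "built U B E Q"
  shows "closed (\<Union>(cell_complex U B E Q))"
proof (rule closed_Union)
  show "finite (cell_complex U B E Q)" using cubical_finite[OF cubical_cell_complex[OF assms]] .
  show "\<forall>C\<in>cell_complex U B E Q. closed C"
  proof
    fix C assume "C \<in> cell_complex U B E Q"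
    then obtain I J where "(I, J) \<in> cells U B E Q" "C = cell I J" by (rule cell_complexE)
    then show "closed C" using compact_imp_closed[OF compact_cell[OF assms]] by simp
  qed
qed

text \<open>A vertex not yet present has weight zero on the whole complex. Hence a new leaf meets
  the complex only in the vertex on which it hangs.\<close>

lemma Union_cell_complex_support:
  assumes b: "built U B E Q" and f: "f \<in> \<Union>(cell_complex U B E Q)" and n: "n \<notin> U \<union> B"
  shows "f n = 0"
proof -
  obtain I J where c: "(I, J) \<in> cells U B E Q" and fc: "f \<in> cell I J"
    using f by (auto elim: cell_complexE)
  have "n \<notin> I \<union> J" using cells_shape(1,2)[OF b c] n by blast
  then show ?thesis by (rule cellD(2)[OF fc])
qed

lemma contractible_singleton: "contractible {a :: 'a::topological_space}"
proof -
  have "contractible_space (top_of_set {a})" by (rule contractible_space_subtopology_singleton)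
  then show ?thesis by (simp only: contractible_space_top_of_set)
qed

lemma contractible_attach_edge:
  assumes X: "contractible X" "closed X" and ij: "i \<noteq> j" and c: "c \<in> {0..1}"
    and int: "X \<inter> cell {i} {j} = segment_map i j ` {c}"
  shows "contractible (X \<union> cell {i} {j})"
proof (rule contractible_Un_collapse[OF X _ _ homeomorphism_segment[OF ij] _ int])
  have "compact (segment_map i j ` {0..1})"
    using homeomorphism_segment[OF ij] by (intro compact_continuous_image) (auto simp: homeomorphism_def)
  then show "closed (cell {i} {j})" using compact_imp_closed segment_ends(3)[OF ij] by simp
  show "retraction {0..1} {c} (\<lambda>_. c)" using c by (simp add: retraction_def)
qed simp

text \<open>The labels follow the path \<open>i\<close>, \<open>j'\<close>, \<open>i'\<close>,
  \<open>j\<close>. Thus the free side \<open>fst z = 0\<close>, missing from \<open>A\<close>,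
  becomes the new edge between \<open>i\<close> and \<open>j\<close>.\<close>

lemma contractible_attach_square:
  assumes X: "contractible X" "closed X" and d: "distinct [i, j', i', j]"
    and int: "X \<inter> cell {i, i'} {j', j} = cell {i} {j'} \<union> cell {i'} {j'} \<union> cell {i'} {j}"
  shows "contractible (X \<union> cell {i, i'} {j', j})"
proof -
  define A where "A = {z :: real \<times> real. z \<in> {0..1} \<times> {0..1} \<and> (snd z = 0 \<or> fst z = 1 \<or> snd z = 1)}"
  obtain r where r: "retraction ({0..1} \<times> {0..1}) A r"
    using unit_square_retraction unfolding A_def .
  have A: "A = {0..1} \<times> {0} \<union> {1} \<times> {0..1} \<union> {0..1} \<times> {1}" unfolding A_def by force
  have int': "X \<inter> cell {i, i'} {j', j} = square_map i j' i' j ` A"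
    unfolding int A image_Un square_sides[OF d] by blast
  have "compact (square_map i j' i' j ` ({0..1} \<times> {0..1}))"
    using homeomorphism_square[OF d] unfolding homeomorphism_def
    by (intro compact_continuous_image compact_Times) simp_all
  then have "closed (cell {i, i'} {j', j})" using compact_imp_closed square_sides(5)[OF d] by simp
  then show ?thesis
    using convex_Times[of "{0..1::real}" "{0..1::real}"]
    by (intro contractible_Un_collapse[OF X _ _ homeomorphism_square[OF d] r int']) simp_all
qed

text \<open>Each rule of \<open>built\<close> glues on a segment along an end point or a square
  along three sides. The work lies in showing that the new cell meets the old complex in nothing
  else: for leaves by the weight of the new vertex, for squares by \<open>cells_Int\<close> and the
  absence of the edge \<open>(i, j)\<close>.\<close>

lemma contractible_cell_complex:
  fixes U B :: "nat set"
  assumes "built U B E Q"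
  shows "contractible (\<Union>(cell_complex U B E Q))"
  using assms
proof (induction rule: built.induct)
  case (edge i j)
  have "cells {i} {j} {(i, j)} {} = {({i}, {}), ({}, {j}), ({i}, {j})}" unfolding cells_def by auto
  then have "\<Union>(cell_complex {i} {j} {(i, j)} {}) = cell {i} {} \<union> cell {} {j} \<union> cell {i} {j}"
    unfolding cell_complex_def by auto
  \<comment> \<open>The initial edge is viewed as attached to one of its own end points, which puts
    it under \<open>contractible_attach_edge\<close> as well.\<close>
  also have "\<dots> = segment_map i j ` {0} \<union> cell {i} {j}"
    unfolding segment_ends(3)[OF edge, symmetric] segment_ends(1,2)[OF edge, symmetric] by auto
  finally have eq: "\<Union>(cell_complex {i} {j} {(i, j)} {}) = segment_map i j ` {0} \<union> cell {i} {j}" .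
  show ?case
    unfolding eq
  proof (rule contractible_attach_edge[OF _ _ edge, of _ 0])
    show "contractible (segment_map i j ` {0})" by (simp add: contractible_singleton)
    show "segment_map i j ` {0} \<inter> cell {i} {j} = segment_map i j ` {0}"
      unfolding segment_ends(3)[OF edge, symmetric] by auto
  qed simp_all
next
  case (leafU U B E Q i j)
  let ?X = "\<Union>(cell_complex U B E Q)"
  have ne: "i \<noteq> j" using leafU.hyps by blast
  have "cells (insert i U) B (insert (i, j) E) Q = insert ({i}, {}) (insert ({i}, {j}) (cells U B E Q))"
    unfolding cells_def by blast
  then have "\<Union>(cell_complex (insert i U) B (insert (i, j) E) Q) = ?X \<union> cell {i} {} \<union> cell {i} {j}"
    unfolding cell_complex_def by auto
  also have "\<dots> = ?X \<union> cell {i} {j}"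
    unfolding segment_ends(3)[OF ne, symmetric] segment_ends(1)[OF ne, symmetric] by auto
  finally have eq: "\<Union>(cell_complex (insert i U) B (insert (i, j) E) Q) = ?X \<union> cell {i} {j}" .
  have sub: "cell {} {j} \<subseteq> ?X \<inter> cell {i} {j}"
  proof -
    have "({}, {j}) \<in> cells U B E Q" using leafU.hyps by (simp add: cells_def)
    then have "cell {} {j} \<subseteq> ?X" using cell_complexI by blast
    moreover have "cell {} {j} \<subseteq> cell {i} {j}"
      unfolding segment_ends(3)[OF ne, symmetric] segment_ends(2)[OF ne, symmetric] by auto
    ultimately show ?thesis by blast
  qed
  have "?X \<inter> cell {i} {j} \<subseteq> cell {} {j}"
  proof
    fix f assume f: "f \<in> ?X \<inter> cell {i} {j}"
    then have i: "f i = 0" using Union_cell_complex_support[OF leafU.hyps(1)] leafU.hyps(2) by blast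
    have f': "f \<in> cell {i} {j}" using f by blast
    have "f n = (if n = j then 1 else 0)" for n
      using f' i unfolding in_cell_edge[OF ne] by auto
    then show "f \<in> cell {} {j}" unfolding in_cell_vertex by (intro ext)
  qed
  with sub have "?X \<inter> cell {i} {j} = segment_map i j ` {1}" unfolding segment_ends(2)[OF ne] by blast
  with contractible_attach_edge[OF leafU.IH closed_Union_cell_complex[OF leafU.hyps(1)] ne, of 1]
  show ?case unfolding eq by simp
next
  case (leafB U B E Q j i)
  let ?X = "\<Union>(cell_complex U B E Q)"
  have ne: "i \<noteq> j" using leafB.hyps by blast
  have "cells U (insert j B) (insert (i, j) E) Q = insert ({}, {j}) (insert ({i}, {j}) (cells U B E Q))"
    unfolding cells_def by blast
  then have "\<Union>(cell_complex U (insert j B) (insert (i, j) E) Q) = ?X \<union> cell {} {j} \<union> cell {i} {j}"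
    unfolding cell_complex_def by auto
  also have "\<dots> = ?X \<union> cell {i} {j}"
    unfolding segment_ends(3)[OF ne, symmetric] segment_ends(2)[OF ne, symmetric] by auto
  finally have eq: "\<Union>(cell_complex U (insert j B) (insert (i, j) E) Q) = ?X \<union> cell {i} {j}" .
  have sub: "cell {i} {} \<subseteq> ?X \<inter> cell {i} {j}"
  proof -
    have "({i}, {}) \<in> cells U B E Q" using leafB.hyps by (simp add: cells_def)
    then have "cell {i} {} \<subseteq> ?X" using cell_complexI by blast
    moreover have "cell {i} {} \<subseteq> cell {i} {j}"
      unfolding segment_ends(3)[OF ne, symmetric] segment_ends(1)[OF ne, symmetric] by auto
    ultimately show ?thesis by blast
  qed
  have "?X \<inter> cell {i} {j} \<subseteq> cell {i} {}"
  proof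
    fix f assume f: "f \<in> ?X \<inter> cell {i} {j}"
    then have j: "f j = 0" using Union_cell_complex_support[OF leafB.hyps(1)] leafB.hyps(2) by blast
    have f': "f \<in> cell {i} {j}" using f by blast
    have "f n = (if n = i then 1 else 0)" for n
      using f' j unfolding in_cell_edge[OF ne] by auto
    then show "f \<in> cell {i} {}" unfolding in_cell_vertex by (intro ext)
  qed
  with sub have "?X \<inter> cell {i} {j} = segment_map i j ` {0}" unfolding segment_ends(1)[OF ne] by blast
  with contractible_attach_edge[OF leafB.IH closed_Union_cell_complex[OF leafB.hyps(1)] ne, of 0]
  show ?case unfolding eq by simp
next
  case (square U B E Q i j' i' j)
  let ?X = "\<Union>(cell_complex U B E Q)" and ?E = "insert (i, j) E" and ?Q = "insert ({i, i'}, {j, j'}) Q"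
  have built': "built U B ?E ?Q" using square.hyps by (rule built.square)
  have q: "({i, i'}, {j, j'}) \<in> cells U B ?E ?Q" by (simp add: cells_def)
  have wf: "U \<inter> B = {}" "E \<subseteq> U \<times> B" using built_wf[OF square.hyps(1)] by simp_all
  have d: "distinct [i, j', i', j]"
    using wf square.hyps(2-5) by auto
  have c_edges: "({i}, {j'}) \<in> cells U B E Q" "({i'}, {j'}) \<in> cells U B E Q" "({i'}, {j}) \<in> cells U B E Q"
    using square.hyps by (simp_all add: cells_def)
  have cells: "cells U B ?E ?Q = insert ({i}, {j}) (insert ({i, i'}, {j, j'}) (cells U B E Q))"
    unfolding cells_def by blast
  have perm: "{j, j'} = {j', j}" by auto
  have ij: "cell {i} {j} \<subseteq> cell {i, i'} {j, j'}"
    by (intro cell_mono) (use d in auto)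
  have "\<Union>(cell_complex U B ?E ?Q) = ?X \<union> cell {i} {j} \<union> cell {i, i'} {j, j'}"
    unfolding cell_complex_def cells by auto
  also have "\<dots> = ?X \<union> cell {i, i'} {j', j}" using ij unfolding perm by blast
  finally have eq: "\<Union>(cell_complex U B ?E ?Q) = ?X \<union> cell {i, i'} {j', j}" .
  have "?X \<inter> cell {i, i'} {j', j} = cell {i} {j'} \<union> cell {i'} {j'} \<union> cell {i'} {j}"
  proof
    have "cell {i} {j'} \<subseteq> cell {i, i'} {j', j}" "cell {i'} {j'} \<subseteq> cell {i, i'} {j', j}"
      "cell {i'} {j} \<subseteq> cell {i, i'} {j', j}"
      by (intro cell_mono; use d in auto)+
    then show "cell {i} {j'} \<union> cell {i'} {j'} \<union> cell {i'} {j} \<subseteq> ?X \<inter> cell {i, i'} {j', j}"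
      using c_edges cell_complexI by blast
    show "?X \<inter> cell {i, i'} {j', j} \<subseteq> cell {i} {j'} \<union> cell {i'} {j'} \<union> cell {i'} {j}"
    proof
      fix f assume f: "f \<in> ?X \<inter> cell {i, i'} {j', j}"
      then obtain I J where c: "(I, J) \<in> cells U B E Q" and fc: "f \<in> cell I J"
        by (auto elim: cell_complexE)
      \<comment> \<open>The old cell is compared with the square inside the enlarged complex, where
        both are cells and \<open>cells_Int\<close> limits their overlap.\<close>
      have c': "(I, J) \<in> cells U B ?E ?Q" using c unfolding cells by simp
      have neq: "(I, J) \<noteq> ({i, i'}, {j, j'})"
      proof
        assume "(I, J) = ({i, i'}, {j, j'})"
        then have "({i, i'}, {j, j'}) \<in> Q" using c cells_card_2[of I J] d by simp
        then show False using square.hyps(6) by force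
      qed
      let ?I = "I \<inter> {i, i'}" and ?J = "J \<inter> {j, j'}"
      have card: "card ?I \<le> 1" "card ?J \<le> 1" using cells_Int[OF built' c' q neq] by simp_all
      have "finite I" "finite J" "I \<subseteq> U" "J \<subseteq> B" and prod: "I \<times> J \<subseteq> E"
        using cells_shape[OF square.hyps(1) c] unfolding cell_shape_def by simp_all
      moreover have "{i, i'} \<subseteq> U" "{j, j'} \<subseteq> B" using wf square.hyps(2-4) by auto
      ultimately have "cell I J \<inter> cell {i, i'} {j, j'} = cell ?I ?J"
        using card wf by (intro cell_Int) blast+
      then have fIJ: "f \<in> cell ?I ?J" using f fc perm by auto
      have "?I = {} \<or> (\<exists>x. ?I = {x})" "?J = {} \<or> (\<exists>x. ?J = {x})"
        using card_le_1_cases[OF _ card(1)] card_le_1_cases[OF _ card(2)] by simp_all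
      then have IJ: "?I = {} \<or> ?I = {i} \<or> ?I = {i'}" "?J = {} \<or> ?J = {j} \<or> ?J = {j'}" by blast+
      \<comment> \<open>An old cell containing both \<open>i\<close> and \<open>j\<close> would have
        them joined by an old edge. This excludes the new side and leaves the three sides of the
        path.\<close>
      have no: "\<not> (?I = {i} \<and> ?J = {j})" using prod square.hyps(5) by blast
      have "?I \<union> ?J \<noteq> {}"
      proof
        assume "?I \<union> ?J = {}"
        then show False using cellD(3)[OF fIJ] by (simp only: sum.empty)
      qed
      then have "(?I \<subseteq> {i} \<and> ?J \<subseteq> {j'}) \<or> (?I \<subseteq> {i'} \<and> ?J \<subseteq> {j'}) \<or> (?I \<subseteq> {i'} \<and> ?J \<subseteq> {j})"
        using IJ no by (elim disjE) simp_all
      moreover have "f \<in> cell {a} {b}" if "?I \<subseteq> {a}" "?J \<subseteq> {b}" "a \<noteq> b" for a b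
        using cell_mono[of "{a}" "{b}" ?I ?J] that card fIJ by auto
      ultimately show "f \<in> cell {i} {j'} \<union> cell {i'} {j'} \<union> cell {i'} {j}"
        using d by auto
    qed
  qed
  then show ?case
    unfolding eq using square.IH closed_Union_cell_complex[OF square.hyps(1)] d
    by (intro contractible_attach_square)
qed

lemma cell_complex_counts:
  assumes b: "built U B E Q" and "Q \<noteq> {}"
  shows "has_dimension (cell_complex U B E Q) cell_dim 2"
    and "card (vertices (cell_complex U B E Q) cell_dim) \<le> card U + card B"
    and "card Q \<le> card (cubes_of_dim (cell_complex U B E Q) cell_dim 2)"
proof -
  have fin: "finite U" "finite B" "finite Q" using built_finite[OF b] by simp_all
  have QC: "(I, J) \<in> cells U B E Q \<and> cell_dim (cell I J) = 2" if "(I, J) \<in> Q" for I J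
  proof -
    have "(I, J) \<in> cells U B E Q" using that by (simp add: cells_def)
    then show ?thesis using cell_dim_cell[OF b] built_square_edges[OF b that] by simp
  qed
  have le: "cell_dim C \<le> 2" if C: "C \<in> cell_complex U B E Q" for C
  proof -
    obtain I J where c: "(I, J) \<in> cells U B E Q" "C = cell I J" using C by (rule cell_complexE)
    have "card I + card J \<le> 4" using cells_shape(3)[OF b c(1)] unfolding cell_shape_def by auto
    then show ?thesis using cell_dim_cell[OF b c(1)] c(2) by simp
  qed
  obtain I J where "(I, J) \<in> Q" using \<open>Q \<noteq> {}\<close> by auto
  then have "cell I J \<in> cell_complex U B E Q" "cell_dim (cell I J) = 2"
    using QC cell_complexI by blast+
  then show "has_dimension (cell_complex U B E Q) cell_dim 2"
    unfolding has_dimension_def using le by blast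
  have "vertices (cell_complex U B E Q) cell_dim \<subseteq> (\<lambda>i. cell {i} {}) ` U \<union> (\<lambda>j. cell {} {j}) ` B"
  proof
    fix C assume C: "C \<in> vertices (cell_complex U B E Q) cell_dim"
    then have "C \<in> cell_complex U B E Q" "cell_dim C = 0" by (simp_all add: cubes_of_dim_def)
    then obtain I J where c: "(I, J) \<in> cells U B E Q" and CIJ: "C = cell I J" by (auto elim: cell_complexE)
    from c show "C \<in> (\<lambda>i. cell {i} {}) ` U \<union> (\<lambda>j. cell {} {j}) ` B"
    proof (cases rule: cells_cases)
      case 4
      then show ?thesis using QC[OF 4] CIJ \<open>cell_dim C = 0\<close> by simp
    next
      case (3 i j)
      then show ?thesis using cell_dim_cell[OF b c] CIJ \<open>cell_dim C = 0\<close> by simp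
    qed (use CIJ in auto)
  qed
  then have "card (vertices (cell_complex U B E Q) cell_dim) \<le> card ((\<lambda>i. cell {i} {}) ` U \<union> (\<lambda>j. cell {} {j}) ` B)"
    using fin by (intro card_mono) simp_all
  also have "\<dots> \<le> card U + card B"
    using card_Un_le card_image_le[OF fin(1)] card_image_le[OF fin(2)] by (rule order_trans[OF _ add_mono])
  finally show "card (vertices (cell_complex U B E Q) cell_dim) \<le> card U + card B" .
  show "card Q \<le> card (cubes_of_dim (cell_complex U B E Q) cell_dim 2)"
  proof (rule card_inj_on_le)
    show "inj_on (\<lambda>(I, J). cell I J) Q"
      using cell_inj[OF b] by (rule inj_on_subset) (simp add: cells_def)
    show "(\<lambda>(I, J). cell I J) ` Q \<subseteq> cubes_of_dim (cell_complex U B E Q) cell_dim 2"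
      using QC cell_complexI by (auto simp: cubes_of_dim_def)
    show "finite (cubes_of_dim (cell_complex U B E Q) cell_dim 2)"
      using cubical_finite[OF cubical_cell_complex[OF b]] by (simp add: cubes_of_dim_def)
  qed
qed

text \<open>Stated for arbitrary bounds \<open>v\<close> and \<open>s\<close>, so that the single
  square and the large square complexes both pass through the same \<open>e\<close>
  cylinders.\<close>

lemma exists_cubical:
  "\<exists>(K :: (nat \<Rightarrow> real) set set) dm. cubical K dm \<and> has_dimension K dm (e + 2) \<and> contractible (\<Union>K) \<and>
     card (vertices K dm) \<le> 2 ^ e * v \<and> s \<le> card (cubes_of_dim K dm (e + 2))"
  if base: "\<exists>(U :: nat set) B E Q. built U B E Q \<and> Q \<noteq> {} \<and> card U + card B \<le> v \<and> s \<le> card Q"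
proof (induction e)
  case 0
  obtain U B :: "nat set" and E Q where b: "built U B E Q" "Q \<noteq> {}" and le: "card U + card B \<le> v" "s \<le> card Q"
    using base by blast
  show ?case
    using cubical_cell_complex[OF b(1)] contractible_cell_complex[OF b(1)] cell_complex_counts[OF b] le
    by (intro exI[of _ "cell_complex U B E Q"] exI[of _ cell_dim]) (simp add: numeral_2_eq_2)
next
  case (Suc e)
  then obtain K :: "(nat \<Rightarrow> real) set set" and dm where K: "cubical K dm" "has_dimension K dm (e + 2)"
    "contractible (\<Union>K)" and le: "card (vertices K dm) \<le> 2 ^ e * v" "s \<le> card (cubes_of_dim K dm (e + 2))"
    by blast
  have "contractible (\<Union>(cylinder_complex K))"
    unfolding Union_cylinder_complex using K(3) by (rule contractible_cylinder)
  then show ?case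
    using cubical_cylinder[OF K(1)] cylinder_complex_counts[OF K(1,2)] le
    by (intro exI[of _ "cylinder_complex K"] exI[of _ "cylinder_dim dm"]) simp
qed

lemma built_many_squares:
  "\<exists>(U :: nat set) B E Q. built U B E Q \<and> Q \<noteq> {} \<and> card U + card B \<le> 12 * 2 ^ k \<and> 4 ^ k \<le> card Q"
proof -
  obtain U B :: "nat set" and E Q where b: "built U B E Q" "card U + card B \<le> 12 * 2 ^ k" "4 ^ k \<le> card Q"
    using contains_biclique_power[of k] unfolding contains_biclique_def by blast
  moreover have "Q \<noteq> {}" using b(3) by auto
  ultimately show ?thesis by blast
qed

theorem proposition1p2:
  fixes d :: nat
  assumes "d \<ge> 2"
  shows "\<exists>c::real. c > 0 \<and>
    (\<forall>n::nat. n \<ge> 2 ^ d \<longrightarrow>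
      (\<exists>(K :: (nat \<Rightarrow> real) set set) dm ch.
         cube_complex K dm ch \<and> has_dimension K dm d \<and> simply_connected (\<Union>K) \<and>
         card (vertices K dm) \<le> n \<and>
         real (card (cubes_of_dim K dm d)) \<ge> c * (real n)\<^sup>2))"
proof -
  define e where "e = d - 2"
  have d: "d = e + 2" using assms by (simp add: e_def)
  \<comment> \<open>Chosen so that \<open>N * 2 ^ k\<close> bounds the vertices left by
    \<open>e\<close> cylinders over the square complex with \<open>4 ^ Suc k\<close> squares. The
    constant of the theorem is \<open>1 / N^2\<close>.\<close>
  define N :: nat where "N = 24 * 2 ^ e"
  have N: "N > 0" by (simp add: N_def)
  have "\<exists>(K :: (nat \<Rightarrow> real) set set) dm ch.
         cube_complex K dm ch \<and> has_dimension K dm d \<and> simply_connected (\<Union>K) \<and>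
         card (vertices K dm) \<le> n \<and>
         real (card (cubes_of_dim K dm d)) \<ge> 1 / (real N)\<^sup>2 * (real n)\<^sup>2"
    if n: "n \<ge> 2 ^ d" for n
  proof -
    have "\<exists>v s. (\<exists>(U :: nat set) B E Q. built U B E Q \<and> Q \<noteq> {} \<and> card U + card B \<le> v \<and> s \<le> card Q) \<and>
      2 ^ e * v \<le> n \<and> n\<^sup>2 \<le> N\<^sup>2 * s"
    proof (cases "n < N")
      \<comment> \<open>For \<open>n < N\<close> the required number of facets is below 1, so a
        single cube suffices. Its \<open>2 ^ e * 4 = 2 ^ d\<close> vertices are the reason for the
        lower bound on \<open>n\<close>.\<close>
      case True
      then have "n\<^sup>2 \<le> N\<^sup>2 * 1" by (simp add: power_mono)
      moreover have "2 ^ e * 4 \<le> n" using n by (simp add: d)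
      moreover have "card {2, 0 :: nat} + card {3, 1 :: nat} \<le> 4" "1 \<le> card {({2, 0 :: nat}, {3, 1 :: nat})}"
        by simp_all
      ultimately show ?thesis using built_single_square by blast
    next
      case False
      then have "n div N > 0" using N by (simp add: div_greater_zero_iff)
      \<comment> \<open>\<open>N * 2 ^ k\<close> is the largest size of this form not exceeding
        \<open>n\<close>. Rounding down to a power of 2 loses less than a factor 2, which is made up
        for by using level \<open>Suc k\<close>: from \<open>n < N * 2 ^ Suc k\<close> one gets
        \<open>n^2\<close> at most \<open>N^2 * 4 ^ Suc k\<close>.\<close>
      then obtain k where k: "2 ^ k \<le> n div N" "n div N < 2 ^ Suc k"
        using ex_power_ivl1[of 2 "n div N"] by auto
      have "2 ^ e * (12 * 2 ^ Suc k) = N * 2 ^ k" by (simp add: N_def)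
      also have "\<dots> \<le> N * (n div N)" using k(1) by simp
      also have "\<dots> \<le> n" by simp
      finally have "2 ^ e * (12 * 2 ^ Suc k) \<le> n" .
      note le = this
      have "n < N * 2 ^ Suc k"
        using k(2) N by (simp add: div_less_iff_less_mult mult.commute)
      then have "n\<^sup>2 \<le> (N * 2 ^ Suc k)\<^sup>2" by (intro power_mono) simp_all
      moreover have "(2 ^ Suc k)\<^sup>2 = (2 * 2 :: nat) ^ Suc k"
        by (simp only: power2_eq_square power_mult_distrib)
      ultimately have "n\<^sup>2 \<le> N\<^sup>2 * 4 ^ Suc k"
        by (simp add: power_mult_distrib)
      with le show ?thesis using built_many_squares by blast
    qed
    then obtain v s where base: "\<exists>(U :: nat set) B E Q. built U B E Q \<and> Q \<noteq> {} \<and> card U + card B \<le> v \<and> s \<le> card Q"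
      and vn: "2 ^ e * v \<le> n" and ns: "n\<^sup>2 \<le> N\<^sup>2 * s" by blast
    obtain K :: "(nat \<Rightarrow> real) set set" and dm where K: "cubical K dm" "has_dimension K dm (e + 2)"
      "contractible (\<Union>K)" "card (vertices K dm) \<le> 2 ^ e * v" "s \<le> card (cubes_of_dim K dm (e + 2))"
      using exists_cubical[OF base, of e] by blast
    obtain ch where "cube_complex K dm ch" using cubical_imp_cube_complex[OF K(1)] by blast
    moreover have "simply_connected (\<Union>K)" using K(3) by (rule contractible_imp_simply_connected_space)
    moreover have "card (vertices K dm) \<le> n" using K(4) vn by linarith
    moreover have "real (card (cubes_of_dim K dm d)) \<ge> 1 / (real N)\<^sup>2 * (real n)\<^sup>2"
    proof -
      have "(real n)\<^sup>2 \<le> (real N)\<^sup>2 * real s"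
        using ns by (metis of_nat_le_iff of_nat_mult of_nat_power)
      then have "1 / (real N)\<^sup>2 * (real n)\<^sup>2 \<le> real s" using N by (simp add: field_simps)
      also have "\<dots> \<le> real (card (cubes_of_dim K dm d))" using K(5) by (simp add: d)
      finally show ?thesis .
    qed
    ultimately show ?thesis using K(2) unfolding d by blast
  qed
  moreover have "1 / (real N)\<^sup>2 > 0" using N by simp
  ultimately show ?thesis by blast
qed

end
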